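(* Let $J$ be a finite-dimensional complex Jordan algebra of rank $3$ whose radical $R$ is nonzero, of dimension $r>0$, and whose semi-simple part $J_{\mathrm{ss}}$ is a simple Jordan algebra of rank $3$; write $J=J_{\mathrm{ss}}\oplus R$ with $J_{\mathrm{ss}}$ embedded as a subalgebra of $J$. For $\varphi\in\mathrm{Aut}(J_{\mathrm{ss}})$ let $J_{\mathrm{ss}}(R,R^\varphi)$ be the vector space $J_{\mathrm{ss}}\oplus R\oplus R$ endowed with the product $$(x,m_1,m_2)\bullet(x',m_1',m_2')=\big(xx',\;xm_1'+x'm_1+m_1m_1',\;\varphi(x)m_2'+\varphi(x')m_2+m_2m_2'\big),$$ the products on the right being taken in $J$. Then for every $\varphi\in\mathrm{Aut}(J_{\mathrm{ss}})$, $J_{\mathrm{ss}}(R,R^\varphi)$ is a Jordan algebra of rank $3$ and dimension $\dim(J_{\mathrm{ss}})+2r$. Consequently the projectivizations of the adjoints of these algebras form a family, parametrized by $\mathrm{Aut}(J_{\mathrm{ss}})$, of quadro-quadric Cremona transformations of $\mathbb P^{\dim(J_{\mathrm{ss}})+2r-1}$.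
   Context: A Jordan algebra is a finite-dimensional commutative complex algebra with unity satisfying $x^2(xy)=x(x^2y)$. Its rank is the dimension of the subalgebra generated by the unity and a general element. The radical $R=\mathrm{Rad}(J)$ is the largest nil (equivalently, nilpotent or solvable) ideal; $J_{\mathrm{ss}}\cong J/R$ is the semi-simple part, which embeds in $J$ as a subalgebra complementary to $R$. For a rank $3$ Jordan algebra with unity $e$ and generic equation $x^3-T(x)x^2+S(x)x-N(x)e=0$ ($T,S,N$ forms of degrees $1,2,3$), the adjoint is $x^\#=x^2-T(x)x+S(x)e$. A Cremona transformation of $\mathbb P^m$ is quadro-quadric if it is given by quadratic forms without common factor and its inverse is also given by quadratic forms without common factor. *)

theory Defs
  imports "HOL-Analysis.Analysis"
begin

text \<open>
  An algebra is given by a scalar multiplication \<open>s\<close> making a type a complex vector space, a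
  carrier \<open>A\<close> that is a subspace of it, and a product \<open>mul\<close> of which only the values on \<open>A\<close>
  matter. Likewise a function on a subspace \<open>V\<close> is a HOL function whose values outside \<open>V\<close>
  are irrelevant.
\<close>

type_synonym 'a scaling = "complex \<Rightarrow> 'a \<Rightarrow> 'a"
type_synonym 'a binop = "'a \<Rightarrow> 'a \<Rightarrow> 'a"

definition linear_map_on ::
    "'a::ab_group_add scaling \<Rightarrow> 'a set \<Rightarrow> 'b::ab_group_add scaling \<Rightarrow> ('a \<Rightarrow> 'b) \<Rightarrow> bool" where
  "linear_map_on s V t f \<longleftrightarrow>
     (\<forall>x\<in>V. \<forall>y\<in>V. f (x + y) = f x + f y) \<and> (\<forall>c. \<forall>x\<in>V. f (s c x) = t c (f x))"

abbreviation linear_functional_on :: "'a::ab_group_add scaling \<Rightarrow> 'a set \<Rightarrow> ('a \<Rightarrow> complex) \<Rightarrow> bool" where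
  "linear_functional_on s V \<equiv> linear_map_on s V (*)"

definition finite_dim :: "'a::ab_group_add scaling \<Rightarrow> 'a set \<Rightarrow> bool" where
  "finite_dim s V \<longleftrightarrow> (\<exists>B. finite B \<and> module.span s B = V)"


section \<open>Polynomial functions, forms and general elements\<close>

inductive poly_fun_on :: "'a::ab_group_add scaling \<Rightarrow> 'a set \<Rightarrow> ('a \<Rightarrow> complex) \<Rightarrow> bool"
  for s :: "'a scaling" and V :: "'a set" where
  const: "poly_fun_on s V (\<lambda>_. c)"
| linear: "linear_functional_on s V f \<Longrightarrow> poly_fun_on s V f"
| add: "poly_fun_on s V f \<Longrightarrow> poly_fun_on s V g \<Longrightarrow> poly_fun_on s V (\<lambda>x. f x + g x)"
| mult: "poly_fun_on s V f \<Longrightarrow> poly_fun_on s V g \<Longrightarrow> poly_fun_on s V (\<lambda>x. f x * g x)"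

text \<open>The scalar field is infinite, so polynomials and polynomial functions need not be distinguished.\<close>

definition form_on :: "'a::ab_group_add scaling \<Rightarrow> 'a set \<Rightarrow> nat \<Rightarrow> ('a \<Rightarrow> complex) \<Rightarrow> bool" where
  "form_on s V d f \<longleftrightarrow> poly_fun_on s V f \<and> (\<forall>c. \<forall>x\<in>V. f (s c x) = c ^ d * f x)"

text \<open>A property holds for a general element of \<open>V\<close> if it holds on a nonempty Zariski open subset
  of \<open>V\<close>; nonempty principal open sets suffice.\<close>

definition generically :: "'a::ab_group_add scaling \<Rightarrow> 'a set \<Rightarrow> ('a \<Rightarrow> bool) \<Rightarrow> bool" where
  "generically s V P \<longleftrightarrow>
     (\<exists>f. poly_fun_on s V f \<and> (\<exists>x\<in>V. f x \<noteq> 0) \<and> (\<forall>x\<in>V. f x \<noteq> 0 \<longrightarrow> P x))"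


section \<open>Jordan algebras\<close>

definition is_unity :: "'a set \<Rightarrow> 'a binop \<Rightarrow> 'a \<Rightarrow> bool" where
  "is_unity A mul u \<longleftrightarrow> u \<in> A \<and> (\<forall>x\<in>A. mul u x = x \<and> mul x u = x)"

definition unity :: "'a set \<Rightarrow> 'a binop \<Rightarrow> 'a" where
  "unity A mul = (THE u. is_unity A mul u)"

definition jordan_algebra :: "'a::ab_group_add scaling \<Rightarrow> 'a set \<Rightarrow> 'a binop \<Rightarrow> bool" where
  "jordan_algebra s A mul \<longleftrightarrow>
     vector_space s \<and> module.subspace s A \<and> finite_dim s A \<and>
     (\<forall>x\<in>A. \<forall>y\<in>A. mul x y \<in> A) \<and>
     (\<forall>x\<in>A. linear_map_on s A s (mul x)) \<and>
     (\<forall>x\<in>A. \<forall>y\<in>A. mul x y = mul y x) \<and>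
     (\<exists>u. is_unity A mul u) \<and>
     (\<forall>x\<in>A. \<forall>y\<in>A. mul (mul x x) (mul x y) = mul x (mul (mul x x) y))"

definition subalgebra :: "'a::ab_group_add scaling \<Rightarrow> 'a set \<Rightarrow> 'a binop \<Rightarrow> 'a set \<Rightarrow> bool" where
  "subalgebra s A mul B \<longleftrightarrow>
     module.subspace s B \<and> B \<subseteq> A \<and> (\<forall>x\<in>B. \<forall>y\<in>B. mul x y \<in> B)"

definition generated_subalgebra ::
    "'a::ab_group_add scaling \<Rightarrow> 'a set \<Rightarrow> 'a binop \<Rightarrow> 'a set \<Rightarrow> 'a set" where
  "generated_subalgebra s A mul X = \<Inter> {B. subalgebra s A mul B \<and> X \<subseteq> B}"

definition has_rank :: "'a::ab_group_add scaling \<Rightarrow> 'a set \<Rightarrow> 'a binop \<Rightarrow> nat \<Rightarrow> bool" where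
  "has_rank s A mul n \<longleftrightarrow>
     generically s A (\<lambda>x. vector_space.dim s (generated_subalgebra s A mul {unity A mul, x}) = n)"

definition ideal_of :: "'a::ab_group_add scaling \<Rightarrow> 'a set \<Rightarrow> 'a binop \<Rightarrow> 'a set \<Rightarrow> bool" where
  "ideal_of s A mul I \<longleftrightarrow>
     module.subspace s I \<and> I \<subseteq> A \<and> (\<forall>a\<in>A. \<forall>x\<in>I. mul a x \<in> I \<and> mul x a \<in> I)"

text \<open>\<open>(mul x ^^ n) x\<close> is the power of \<open>x\<close> with exponent \<open>n + 1\<close>.\<close>

definition nil_ideal :: "'a::ab_group_add scaling \<Rightarrow> 'a set \<Rightarrow> 'a binop \<Rightarrow> 'a set \<Rightarrow> bool" where
  "nil_ideal s A mul I \<longleftrightarrow> ideal_of s A mul I \<and> (\<forall>x\<in>I. \<exists>n. (mul x ^^ n) x = 0)"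

definition is_radical :: "'a::ab_group_add scaling \<Rightarrow> 'a set \<Rightarrow> 'a binop \<Rightarrow> 'a set \<Rightarrow> bool" where
  "is_radical s A mul R \<longleftrightarrow> nil_ideal s A mul R \<and> (\<forall>I. nil_ideal s A mul I \<longrightarrow> I \<subseteq> R)"

definition simple_algebra :: "'a::ab_group_add scaling \<Rightarrow> 'a set \<Rightarrow> 'a binop \<Rightarrow> bool" where
  "simple_algebra s A mul \<longleftrightarrow>
     (\<exists>x\<in>A. \<exists>y\<in>A. mul x y \<noteq> 0) \<and> (\<forall>I. ideal_of s A mul I \<longrightarrow> I = {0} \<or> I = A)"

definition algebra_automorphisms ::
    "'a::ab_group_add scaling \<Rightarrow> 'a set \<Rightarrow> 'a binop \<Rightarrow> ('a \<Rightarrow> 'a) set" where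
  "algebra_automorphisms s A mul =
     {\<phi>. bij_betw \<phi> A A \<and> linear_map_on s A s \<phi> \<and>
          (\<forall>x\<in>A. \<forall>y\<in>A. \<phi> (mul x y) = mul (\<phi> x) (\<phi> y))}"

definition generic_cubic_equation ::
    "'a::ab_group_add scaling \<Rightarrow> 'a set \<Rightarrow> 'a binop \<Rightarrow>
     ('a \<Rightarrow> complex) \<Rightarrow> ('a \<Rightarrow> complex) \<Rightarrow> ('a \<Rightarrow> complex) \<Rightarrow> bool" where
  "generic_cubic_equation s A mul T S N \<longleftrightarrow>
     form_on s A 1 T \<and> form_on s A 2 S \<and> form_on s A 3 N \<and>
     (\<forall>x\<in>A. mul x (mul x x) - s (T x) (mul x x) + s (S x) x - s (N x) (unity A mul) = 0)"

definition jordan_adjoint ::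
    "'a::ab_group_add scaling \<Rightarrow> 'a set \<Rightarrow> 'a binop \<Rightarrow>
     ('a \<Rightarrow> complex) \<Rightarrow> ('a \<Rightarrow> complex) \<Rightarrow> 'a \<Rightarrow> 'a" where
  "jordan_adjoint s A mul T S x = mul x x - s (T x) x + s (S x) (unity A mul)"


section \<open>Quadro-quadric Cremona transformations\<close>

text \<open>
  Rational self-maps of the projective space of lines in \<open>V\<close> are given by their lifts to \<open>V\<close> in
  homogeneous coordinates. The homogeneous components of \<open>F\<close> are the compositions of \<open>F\<close> with the
  linear functionals on \<open>V\<close>, which avoids the choice of a basis.
\<close>

definition quadratic_map_on :: "'a::ab_group_add scaling \<Rightarrow> 'a set \<Rightarrow> ('a \<Rightarrow> 'a) \<Rightarrow> bool" where
  "quadratic_map_on s V F \<longleftrightarrow>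
     (\<forall>x\<in>V. F x \<in> V) \<and>
     (\<forall>l. linear_functional_on s V l \<longrightarrow> form_on s V 2 (\<lambda>x. l (F x)))"

definition no_common_factor_on :: "'a::ab_group_add scaling \<Rightarrow> 'a set \<Rightarrow> ('a \<Rightarrow> 'a) \<Rightarrow> bool" where
  "no_common_factor_on s V F \<longleftrightarrow>
     (\<forall>h. poly_fun_on s V h \<and>
          (\<forall>l. linear_functional_on s V l \<longrightarrow>
               (\<exists>g. poly_fun_on s V g \<and> (\<forall>x\<in>V. l (F x) = h x * g x)))
        \<longrightarrow> (\<exists>c. \<forall>x\<in>V. h x = c))"

text \<open>The composition \<open>G \<circ> F\<close> is defined, and is the identity, as a rational map of the projective
  space of \<open>V\<close>.\<close>

definition proj_left_inverse_on ::
    "'a::ab_group_add scaling \<Rightarrow> 'a set \<Rightarrow> ('a \<Rightarrow> 'a) \<Rightarrow> ('a \<Rightarrow> 'a) \<Rightarrow> bool" where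
  "proj_left_inverse_on s V G F \<longleftrightarrow>
     generically s V (\<lambda>x. F x \<noteq> 0 \<and> (\<exists>c. c \<noteq> 0 \<and> G (F x) = s c x))"

definition quadro_quadric_cremona ::
    "'a::ab_group_add scaling \<Rightarrow> 'a set \<Rightarrow> nat \<Rightarrow> ('a \<Rightarrow> 'a) \<Rightarrow> bool" where
  "quadro_quadric_cremona s V m F \<longleftrightarrow>
     vector_space s \<and> module.subspace s V \<and> finite_dim s V \<and> vector_space.dim s V = m + 1 \<and>
     quadratic_map_on s V F \<and> no_common_factor_on s V F \<and>
     (\<exists>G. quadratic_map_on s V G \<and> no_common_factor_on s V G \<and>
          proj_left_inverse_on s V G F \<and> proj_left_inverse_on s V F G)"


section \<open>The twisted double of the radical\<close>

abbreviation scale3 :: "'a::ab_group_add scaling \<Rightarrow> ('a \<times> 'a \<times> 'a) scaling" where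
  "scale3 s \<equiv> module_prod.scale s (module_prod.scale s s)"

fun double_mult ::
    "'a::ab_group_add binop \<Rightarrow> ('a \<Rightarrow> 'a) \<Rightarrow> ('a \<times> 'a \<times> 'a) binop" where
  "double_mult mul \<phi> (x, m\<^sub>1, m\<^sub>2) (x', m\<^sub>1', m\<^sub>2') =
     (mul x x',
      mul x m\<^sub>1' + mul x' m\<^sub>1 + mul m\<^sub>1 m\<^sub>1',
      mul (\<phi> x) m\<^sub>2' + mul (\<phi> x') m\<^sub>2 + mul m\<^sub>2 m\<^sub>2')"

end

theory Submission
  imports Defs "HOL-Computational_Algebra.Fundamental_Theorem_Algebra"
begin

text \<open>
  The map \<open>(x, m\<^sub>1, m\<^sub>2) \<mapsto> (x + m\<^sub>1, \<phi> x + m\<^sub>2)\<close> embeds the twisted double as a subalgebra of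
  \<open>J \<times> J\<close>, so the Jordan identity is inherited. A general element of \<open>J\<close> satisfies a cubic equation
  that survives reduction modulo the ideal \<open>R\<close>; hence the cubic equations of \<open>x + m\<^sub>1\<close> and \<open>\<phi> x + m\<^sub>2\<close> are
  those of \<open>x\<close> and \<open>\<phi> x\<close>, which coincide because \<open>\<phi>\<close> is an automorphism. So the twisted double has
  rank 3.

  In any Jordan algebra of rank 3 the coefficient \<open>T\<close> of the cubic equation is a rational function.
  The roots of the equation are eigenvalues of the multiplication by \<open>x\<close>, so \<open>T\<close> grows at most
  linearly along lines and is therefore linear; then \<open>S\<close> is the polynomial \<open>(T(x)\<^sup>2 - T(x\<^sup>2)) / 2\<close>, and
  \<open>N\<close> is obtained from the equation itself. Computing in the associative algebra generated by a
  general \<open>x\<close>, the adjoint satisfies \<open>(x\<^sup>#)\<^sup># = N(x) x\<close> and is its own inverse.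
\<close>

section \<open>Polynomial functions on finite-dimensional spaces\<close>

lemma linear_map_onD:
  assumes "linear_map_on s V t f"
  shows "x \<in> V \<Longrightarrow> y \<in> V \<Longrightarrow> f (x + y) = f x + f y" "x \<in> V \<Longrightarrow> f (s c x) = t c (f x)"
  using assms unfolding linear_map_on_def by auto

lemma linear_map_onI:
  assumes "\<And>x y. x \<in> V \<Longrightarrow> y \<in> V \<Longrightarrow> f (x + y) = f x + f y"
    and "\<And>c x. x \<in> V \<Longrightarrow> f (s c x) = t c (f x)"
  shows "linear_map_on s V t f"
  using assms unfolding linear_map_on_def by auto

locale fd_space = vector_space s
  for s :: "complex \<Rightarrow> 'a::ab_group_add \<Rightarrow> 'a" +
  fixes V :: "'a set"
  assumes subspace_V: "subspace V" and finite_dim_V: "finite_dim s V"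
begin

lemma in_V [simp, intro]:
  "0 \<in> V" "x \<in> V \<Longrightarrow> y \<in> V \<Longrightarrow> x + y \<in> V" "x \<in> V \<Longrightarrow> y \<in> V \<Longrightarrow> x - y \<in> V"
  "x \<in> V \<Longrightarrow> s c x \<in> V" "x \<in> V \<Longrightarrow> - x \<in> V"
  using subspace_V by (auto simp: subspace_0 subspace_add subspace_diff subspace_scale subspace_neg)

abbreviation "functional \<equiv> linear_functional_on s V"
abbreviation "pfun \<equiv> poly_fun_on s V"

lemma functional_diff:
  assumes l: "functional l" and x: "x \<in> V" and y: "y \<in> V"
  shows "l (x - y) = l x - l y"
  using linear_map_onD(1)[OF l in_V(3)[OF x y] y] by (simp add: algebra_simps)

lemma functional_0: "functional l \<Longrightarrow> l 0 = 0"
  using functional_diff[of l 0 0] by simp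

lemma functional_sum:
  assumes "functional l" "\<And>b. b \<in> B \<Longrightarrow> g b \<in> V"
  shows "l (\<Sum>b\<in>B. g b) = (\<Sum>b\<in>B. l (g b))"
  using assms(2)
proof (induction B rule: infinite_finite_induct)
  case (insert x F)
  then show ?case
    by (simp add: linear_map_onD(1)[OF assms(1)] subspace_sum[OF subspace_V])
qed (use functional_0[OF assms(1)] in auto)

text \<open>\<open>poly_fun_on\<close> speaks of total functions, whose values off \<open>V\<close>
  are arbitrary. Since \<open>g - f\<close> vanishes on \<open>V\<close>, it counts as a linear
  functional on \<open>V\<close> and may be added to \<open>f\<close>.\<close>

lemma pfun_cong:
  assumes "pfun f" "\<And>x. x \<in> V \<Longrightarrow> f x = g x"
  shows "pfun g"
proof -
  have "functional (\<lambda>x. g x - f x)"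
    by (rule linear_map_onI) (simp_all add: assms(2)[symmetric])
  then have "pfun (\<lambda>x. f x + (g x - f x))"
    by (intro poly_fun_on.add assms(1) poly_fun_on.linear)
  then show ?thesis by simp
qed

lemma pfun_diff: "pfun f \<Longrightarrow> pfun g \<Longrightarrow> pfun (\<lambda>x. f x - g x)"
  using poly_fun_on.add[OF _ poly_fun_on.mult[OF poly_fun_on.const[of s V "-1"]], of f g] by simp

lemma pfun_power: "pfun f \<Longrightarrow> pfun (\<lambda>x. f x ^ n)"
  by (induction n) (auto intro: poly_fun_on.intros)

lemma pfun_sum: "(\<And>b. b \<in> B \<Longrightarrow> pfun (f b)) \<Longrightarrow> pfun (\<lambda>x. \<Sum>b\<in>B. f b x)"
  by (induction B rule: infinite_finite_induct) (auto intro: poly_fun_on.intros)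

lemmas pfun_intros = poly_fun_on.const poly_fun_on.add poly_fun_on.mult pfun_diff pfun_power

text \<open>Restriction to lines is how facts on polynomials in one variable (finitely many roots,
  divisibility) reach polynomial functions on \<open>V\<close>.\<close>

lemma pfun_line:
  assumes "pfun f" "a \<in> V" "b \<in> V"
  shows "\<exists>p. \<forall>t. f (a + s t b) = poly p t"
  using assms(1)
proof induction
  case (const c)
  show ?case by (rule exI[of _ "[:c:]"]) simp
next
  case (linear f)
  show ?case by (rule exI[of _ "[:f a, f b:]"]) (use assms in \<open>simp add: linear_map_onD[OF linear]\<close>)
next
  case (add f g)
  then obtain p q where "\<forall>t. f (a + s t b) = poly p t" "\<forall>t. g (a + s t b) = poly q t" by blast
  then show ?case by (intro exI[of _ "p + q"]) simp
next
  case (mult f g)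
  then obtain p q where "\<forall>t. f (a + s t b) = poly p t" "\<forall>t. g (a + s t b) = poly q t" by blast
  then show ?case by (intro exI[of _ "p * q"]) simp
qed

lemma pfun_translate:
  assumes "pfun f" "a \<in> V"
  shows "pfun (\<lambda>x. f (a + x))"
  using assms(1)
proof induction
  case (linear f)
  have "pfun (\<lambda>x. f a + f x)" by (intro poly_fun_on.intros linear)
  then show ?case by (rule pfun_cong) (use assms in \<open>simp add: linear_map_onD[OF linear]\<close>)
qed (auto intro: poly_fun_on.intros)

end

lemma poly_nonroot:
  fixes p :: "complex poly"
  assumes "p \<noteq> 0" "finite X"
  shows "\<exists>t. t \<notin> X \<and> poly p t \<noteq> 0"
proof -
  have "finite (X \<union> {t. poly p t = 0})" using assms by (simp add: poly_roots_finite)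
  then show ?thesis using infinite_UNIV_char_0[where 'a=complex] by (metis (mono_tags, lifting) UNIV_eq_I UnCI mem_Collect_eq)
qed

lemma poly_eq_cofinite:
  fixes p q :: "complex poly"
  assumes "finite X" "\<And>t. t \<notin> X \<Longrightarrow> poly p t = poly q t"
  shows "p = q"
proof (rule ccontr)
  assume "p \<noteq> q"
  then show False using poly_nonroot[of "p - q" X] assms by auto
qed

section \<open>General elements and polynomial maps\<close>

context fd_space
begin

abbreviation "generic \<equiv> generically s V"

text \<open>This is the irreducibility of \<open>V\<close>. On the line joining a point where
  \<open>f\<close> is nonzero to one where \<open>g\<close> is nonzero, both restrict to nonzero
  polynomials in one variable, so their product has a non-root.\<close>

lemma generic_conj:
  assumes "generic P" "generic Q"
  shows "generic (\<lambda>x. P x \<and> Q x)"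
proof -
  obtain f a where f: "pfun f" "a \<in> V" "f a \<noteq> 0" "\<And>x. x \<in> V \<Longrightarrow> f x \<noteq> 0 \<Longrightarrow> P x"
    using assms(1) unfolding generically_def by blast
  obtain g b where g: "pfun g" "b \<in> V" "g b \<noteq> 0" "\<And>x. x \<in> V \<Longrightarrow> g x \<noteq> 0 \<Longrightarrow> Q x"
    using assms(2) unfolding generically_def by blast
  obtain p where p: "\<forall>t. f (a + s t (b - a)) = poly p t"
    using pfun_line[OF f(1) f(2), of "b - a"] f g by auto
  obtain q where q: "\<forall>t. g (a + s t (b - a)) = poly q t"
    using pfun_line[OF g(1) f(2), of "b - a"] f g by auto
  have "p \<noteq> 0" using p[rule_format, of 0] f(3) by auto
  moreover have "q \<noteq> 0" using q[rule_format, of 1] g(3) by auto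
  ultimately obtain t where t: "poly (p * q) t \<noteq> 0" using poly_nonroot[of "p * q" "{}"] by auto
  have "pfun (\<lambda>x. f x * g x)" by (intro poly_fun_on.mult f g)
  moreover have "f (a + s t (b - a)) * g (a + s t (b - a)) \<noteq> 0" using p q t by simp
  ultimately show ?thesis unfolding generically_def using f g by (intro exI[of _ "\<lambda>x. f x * g x"]) auto
qed

lemma generic_mono: "generic P \<Longrightarrow> (\<And>x. x \<in> V \<Longrightarrow> P x \<Longrightarrow> Q x) \<Longrightarrow> generic Q"
  unfolding generically_def by blast

lemma generic_ex: "generic P \<Longrightarrow> \<exists>x\<in>V. P x"
  unfolding generically_def by blast

lemma generic_nonzero: "pfun f \<Longrightarrow> a \<in> V \<Longrightarrow> f a \<noteq> 0 \<Longrightarrow> generic (\<lambda>x. f x \<noteq> 0)"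
  unfolding generically_def by blast

lemma generic_translate:
  assumes "generic P" "a \<in> V"
  shows "generic (\<lambda>x. P (a + x))"
proof -
  obtain f b where f: "pfun f" "b \<in> V" "f b \<noteq> 0" "\<And>x. x \<in> V \<Longrightarrow> f x \<noteq> 0 \<Longrightarrow> P x"
    using assms(1) unfolding generically_def by blast
  have "f (a + (b - a)) \<noteq> 0" using f by simp
  then show ?thesis unfolding generically_def
    using f assms by (intro exI[of _ "\<lambda>x. f (a + x)"])
      (auto intro!: pfun_translate bexI[of _ "b - a"])
qed

text \<open>Identity principle: a difference at one point would make the values differ generically,
  and the two generic conditions would share a point.\<close>

lemma pfun_eq_generic:
  assumes "pfun f" "pfun g" "generic (\<lambda>x. f x = g x)" "x \<in> V"
  shows "f x = g x"
proof (rule ccontr)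
  assume "f x \<noteq> g x"
  then have "generic (\<lambda>x. f x - g x \<noteq> 0)"
    using generic_nonzero[OF pfun_diff[OF assms(1,2)] assms(4)] by simp
  from generic_ex[OF generic_conj[OF this assms(3)]] show False by auto
qed

lemma coordinates:
  obtains B c where "finite B" "B \<subseteq> V" "\<And>b. functional (c b)" 
    "\<And>x. x \<in> V \<Longrightarrow> x = (\<Sum>b\<in>B. s (c b x) b)"
proof -
  obtain B0 where B0: "finite B0" "span B0 = V"
    using finite_dim_V unfolding finite_dim_def by blast
  obtain B where B: "B \<subseteq> B0" "independent B" "B0 \<subseteq> span B"
    using maximal_independent_subset[of B0] by blast
  have sp: "span B = V" using B B0 by (metis span_eq span_mono span_span subset_antisym)
  show ?thesis
  proof (rule that[of B "\<lambda>b x. representation B x b"])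
    show "finite B" using B B0 finite_subset by blast
    show "B \<subseteq> V" using B B0 span_superset by auto
    show "functional (\<lambda>x. representation B x b)" for b
      by (rule linear_map_onI) (simp_all add: representation_add representation_scale B sp)
    fix x assume "x \<in> V"
    then show "x = (\<Sum>b\<in>B. s (representation B x b) b)"
      using sum_representation_eq[of B x B] B sp \<open>finite B\<close> by simp
  qed
qed

lemma eq_if_functionals_eq:
  assumes "x \<in> V" "y \<in> V" "\<And>l. functional l \<Longrightarrow> l x = l y"
  shows "x = y"
proof -
  obtain B c where B: "finite B" "B \<subseteq> V" "\<And>b. functional (c b)" 
    "\<And>x. x \<in> V \<Longrightarrow> x = (\<Sum>b\<in>B. s (c b x) b)" by (rule coordinates) blast
  show ?thesis using B(4)[OF assms(1)] B(4)[OF assms(2)] assms(3)[OF B(3)] by simp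
qed

text \<open>Polynomial self-maps of \<open>V\<close>. Testing on all linear functionals avoids a
  basis and matches the form of \<open>quadratic_map_on\<close>.\<close>

definition pmap :: "('a \<Rightarrow> 'a) \<Rightarrow> bool" where
  "pmap F \<longleftrightarrow> (\<forall>x\<in>V. F x \<in> V) \<and> (\<forall>l. functional l \<longrightarrow> pfun (\<lambda>x. l (F x)))"

lemma pmapI:
  assumes "\<And>x. x \<in> V \<Longrightarrow> F x \<in> V" "\<And>l. functional l \<Longrightarrow> pfun (\<lambda>x. l (F x))"
  shows "pmap F"
  using assms unfolding pmap_def by blast

lemma pmapD: "pmap F \<Longrightarrow> x \<in> V \<Longrightarrow> F x \<in> V" "pmap F \<Longrightarrow> functional l \<Longrightarrow> pfun (\<lambda>x. l (F x))"
  unfolding pmap_def by auto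

lemma pmap_id: "pmap (\<lambda>x. x)"
  by (rule pmapI) (auto intro: poly_fun_on.linear)

lemma pmap_const: "a \<in> V \<Longrightarrow> pmap (\<lambda>_. a)"
  by (rule pmapI) (auto intro: poly_fun_on.const)

lemma pmap_add:
  assumes F: "pmap F" and G: "pmap G" shows "pmap (\<lambda>x. F x + G x)"
proof (rule pmapI)
  fix l assume l: "functional l"
  have "pfun (\<lambda>x. l (F x) + l (G x))" by (intro pfun_intros pmapD F G l)
  then show "pfun (\<lambda>x. l (F x + G x))"
    by (rule pfun_cong) (simp add: linear_map_onD(1)[OF l] pmapD F G)
qed (use F G in \<open>auto dest: pmapD\<close>)

lemma pmap_scale:
  assumes F: "pmap F" and f: "pfun f" shows "pmap (\<lambda>x. s (f x) (F x))"
proof (rule pmapI)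
  fix l assume l: "functional l"
  have "pfun (\<lambda>x. f x * l (F x))" by (intro pfun_intros pmapD F f l)
  then show "pfun (\<lambda>x. l (s (f x) (F x)))"
    by (rule pfun_cong) (simp add: linear_map_onD(2)[OF l] pmapD F)
qed (use F in \<open>auto dest: pmapD\<close>)

lemma pmap_diff: "pmap F \<Longrightarrow> pmap G \<Longrightarrow> pmap (\<lambda>x. F x - G x)"
  using pmap_add[of F "\<lambda>x. s (-1) (G x)"] pmap_scale[OF _ poly_fun_on.const, of G "-1"] by simp

lemmas pmap_intros = pmap_id pmap_const pmap_add pmap_scale pmap_diff

lemma pfun_comp:
  assumes "pfun f" "pmap F"
  shows "pfun (\<lambda>x. f (F x))"
  using assms(1) by induction (auto intro: poly_fun_on.intros pmapD assms(2))

lemma pmap_eq_generic: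
  assumes F: "pmap F" and G: "pmap G" and gen: "generic (\<lambda>x. F x = G x)" and x: "x \<in> V"
  shows "F x = G x"
proof (rule eq_if_functionals_eq)
  fix l assume l: "functional l"
  show "l (F x) = l (G x)"
    by (rule pfun_eq_generic[OF pmapD(2)[OF F l] pmapD(2)[OF G l] _ x])
      (rule generic_mono[OF gen], simp)
qed (use x F G in \<open>auto dest: pmapD\<close>)

text \<open>Expanding only the first argument in coordinates writes \<open>l (m (F x) (G x))\<close>
  as a finite sum of products \<open>c b (F x) * l (m b (G x))\<close>; each factor is a linear
  functional applied to a polynomial map.\<close>

lemma pmap_bilinear:
  assumes cl: "\<And>x y. x \<in> V \<Longrightarrow> y \<in> V \<Longrightarrow> m x y \<in> V"
    and lin1: "\<And>y. y \<in> V \<Longrightarrow> linear_map_on s V s (\<lambda>x. m x y)"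
    and lin2: "\<And>x. x \<in> V \<Longrightarrow> linear_map_on s V s (m x)"
    and F: "pmap F" and G: "pmap G"
  shows "pmap (\<lambda>x. m (F x) (G x))"
proof (rule pmapI)
  show "x \<in> V \<Longrightarrow> m (F x) (G x) \<in> V" for x using cl F G by (auto dest: pmapD)
  fix l assume l: "functional l"
  obtain B c where B: "finite B" "B \<subseteq> V" "\<And>b. functional (c b)" 
    "\<And>x. x \<in> V \<Longrightarrow> x = (\<Sum>b\<in>B. s (c b x) b)" by (rule coordinates) blast
  have 1: "l (m y z) = (\<Sum>b\<in>B. c b y * l (m b z))" if "y \<in> V" "z \<in> V" for y z
  proof -
    have lm: "functional (\<lambda>y. l (m y z))"
      by (rule linear_map_onI)
        (simp_all add: linear_map_onD[OF lin1] linear_map_onD[OF l] cl that)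
    have "l (m (\<Sum>b\<in>B. s (c b y) b) z) = (\<Sum>b\<in>B. l (m (s (c b y) b) z))"
      by (rule functional_sum[OF lm]) (use B in auto)
    also have "\<dots> = (\<Sum>b\<in>B. c b y * l (m b z))"
      by (rule sum.cong) (use B(2) linear_map_onD(2)[OF lm] in auto)
    finally show ?thesis using B(4)[OF that(1)] by simp
  qed
  have "pfun (\<lambda>x. \<Sum>b\<in>B. c b (F x) * l (m b (G x)))"
  proof (intro pfun_sum poly_fun_on.mult)
    fix b assume b: "b \<in> B"
    show "pfun (\<lambda>x. c b (F x))" using pmapD(2)[OF F B(3)] .
    have "functional (\<lambda>z. l (m b z))"
      by (rule linear_map_onI)
        (use b B in \<open>auto simp: linear_map_onD[OF lin2] linear_map_onD[OF l] cl subset_iff\<close>)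
    then show "pfun (\<lambda>x. l (m b (G x)))" using pmapD(2)[OF G] by blast
  qed
  then show "pfun (\<lambda>x. l (m (F x) (G x)))"
    by (rule pfun_cong) (simp add: 1 pmapD F G)
qed

end

lemma poly_fun_on_comp_linear:
  assumes "poly_fun_on t W f" "linear_map_on s V t F" "\<And>x. x \<in> V \<Longrightarrow> F x \<in> W"
  shows "poly_fun_on s V (\<lambda>x. f (F x))"
  using assms(1)
proof induction
  case (linear f)
  have "linear_functional_on s V (\<lambda>x. f (F x))"
    by (rule linear_map_onI)
      (simp_all add: linear_map_onD[OF assms(2)] linear_map_onD[OF linear] assms(3))
  then show ?case by (rule poly_fun_on.linear)
qed (auto intro: poly_fun_on.intros)

text \<open>Surjectivity keeps the pulled-back polynomial from vanishing identically. This carries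
  generic conditions on an algebra back to the twisted double.\<close>

lemma generically_comp_linear:
  assumes "generically t W P" "linear_map_on s V t F" "F ` V = W"
  shows "generically s V (\<lambda>x. P (F x))"
proof -
  obtain f b where f: "poly_fun_on t W f" "b \<in> W" "f b \<noteq> 0" "\<And>x. x \<in> W \<Longrightarrow> f x \<noteq> 0 \<Longrightarrow> P x"
    using assms(1) unfolding generically_def by blast
  show ?thesis unfolding generically_def
  proof (intro exI[of _ "\<lambda>x. f (F x)"] conjI)
    show "poly_fun_on s V (\<lambda>x. f (F x))"
      by (rule poly_fun_on_comp_linear[OF f(1) assms(2)]) (use assms(3) in auto)
  qed (use f assms(3) in auto)
qed

section \<open>Rational functions of linear growth in one variable\<close>

text \<open>Induction on the degree of \<open>g\<close>. At a root \<open>t0\<close> of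
  \<open>g\<close> the bound, passed to the limit by continuity of \<open>K\<close>, forces
  \<open>f\<close> to vanish too. Cancelling the common linear factor keeps the bound except at
  \<open>t0\<close>, which joins the finite exceptional set.\<close>

lemma dvd_if_bounded:
  fixes f g :: "complex poly" and K :: "complex \<Rightarrow> real"
  assumes "finite X" "continuous_on UNIV K" "\<And>t. t \<notin> X \<Longrightarrow> norm (poly f t) \<le> K t * norm (poly g t)"
    "g \<noteq> 0"
  shows "g dvd f"
  using assms
proof (induction "degree g" arbitrary: f g X)
  case 0
  then show ?case by (metis is_unit_iff_degree unit_imp_dvd)
next
  case (Suc n)
  have "\<not> constant (poly g)" using Suc(2) constant_degree[of g] by simp
  then obtain t0 where t0: "poly g t0 = 0" using fundamental_theorem_of_algebra by blast
  have "poly f t0 = 0"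
  proof -
    have 1: "((\<lambda>t. norm (poly f t)) \<longlongrightarrow> norm (poly f t0)) (at t0)"
      by (intro tendsto_intros poly_isCont[unfolded isCont_def])
    have 2: "((\<lambda>t. K t * norm (poly g t)) \<longlongrightarrow> K t0 * norm (poly g t0)) (at t0)"
      using Suc.prems(2) by (intro tendsto_intros poly_isCont[unfolded isCont_def])
        (simp add: continuous_on_eq_continuous_at isCont_def)
    have 3: "eventually (\<lambda>t. norm (poly f t) \<le> K t * norm (poly g t)) (at t0)"
    proof -
      have "open (- (X - {t0}))" using Suc.prems(1) by (intro open_Compl finite_imp_closed) simp
      then show ?thesis unfolding eventually_at_topological using Suc.prems(3)
        by (intro exI[of _ "- (X - {t0})"]) auto
    qed
    have "norm (poly f t0) \<le> K t0 * norm (poly g t0)"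
      by (rule tendsto_le[OF at_neq_bot 2 1 3])
    then show ?thesis using t0 by simp
  qed
  then obtain f1 where f1: "f = [:-t0, 1:] * f1" by (metis poly_eq_0_iff_dvd dvdE)
  obtain g1 where g1: "g = [:-t0, 1:] * g1" using t0 by (metis poly_eq_0_iff_dvd dvdE)
  have "g1 \<noteq> 0" using g1 Suc.prems by auto
  have "g1 dvd f1"
  proof (rule Suc(1))
    show "n = degree g1" using Suc(2) \<open>g1 \<noteq> 0\<close> unfolding g1 by (subst (asm) degree_mult_eq) auto
    show "finite (insert t0 X)" using Suc.prems by simp
    show "norm (poly f1 t) \<le> K t * norm (poly g1 t)" if "t \<notin> insert t0 X" for t
    proof -
      have "norm (t - t0) * norm (poly f1 t) \<le> norm (t - t0) * (K t * norm (poly g1 t))"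
        using Suc.prems(3)[of t] that unfolding f1 g1 poly_mult norm_mult by (simp add: ac_simps)
      then show ?thesis using that by simp
    qed
  qed (use Suc.prems \<open>g1 \<noteq> 0\<close> in auto)
  then show ?case unfolding f1 g1 by (rule mult_dvd_mono[OF dvd_refl])
qed

text \<open>The quotient \<open>q\<close> is a polynomial by \<open>dvd_if_bounded\<close>. Writing
  it as \<open>a + t * (b + t * q2 t)\<close>, a nonzero \<open>q2\<close> would make the inner
  factor tend to infinity, whereas the bound on \<open>q\<close> keeps that factor below
  \<open>norm K + norm L + norm a\<close> for large \<open>t\<close>.\<close>

lemma affine_quotient_if_bounded:
  fixes f g :: "complex poly"
  assumes "finite X" "\<And>t. t \<notin> X \<Longrightarrow> norm (poly f t) \<le> (K + L * norm t) * norm (poly g t)"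
    "g \<noteq> 0"
  shows "\<exists>a b. f = [:a, b:] * g"
proof -
  have "g dvd f"
    by (rule dvd_if_bounded[OF assms(1) _ assms(2,3)]) (intro continuous_intros)
  then obtain q where q: "f = q * g" by (metis dvdE mult.commute)
  obtain a q1 where q1: "q = pCons a q1" by (cases q)
  obtain b q2 where q2: "q1 = pCons b q2" by (cases q1)
  have "q2 = 0"
  proof (rule ccontr)
    assume "q2 \<noteq> 0"
    from poly_infinity[OF this, of "norm K + norm L + norm a + 1" b]
    obtain r where r: "\<And>z. r \<le> norm z \<Longrightarrow> norm K + norm L + norm a + 1 \<le> norm (poly q1 z)"
      unfolding q2 by blast
    let ?Z = "X \<union> {t. poly g t = 0}"
    have fin: "finite ?Z" using assms by (simp add: poly_roots_finite)
    have "infinite (UNIV - ?Z - cball 0 (max r 1))"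
    proof
      assume "finite (UNIV - ?Z - cball 0 (max r 1))"
      then have "bounded (UNIV - ?Z - cball 0 (max r 1) \<union> ?Z \<union> cball 0 (max r 1) :: complex set)"
        using fin finite_imp_bounded by (intro bounded_Un[THEN iffD2] conjI) auto
      moreover have "UNIV - ?Z - cball 0 (max r 1) \<union> ?Z \<union> cball 0 (max r 1) = (UNIV :: complex set)"
        by auto
      ultimately show False using not_bounded_UNIV by metis
    qed
    then have "UNIV - ?Z - cball 0 (max r 1) \<noteq> {}" by (metis finite.emptyI)
    then obtain t where "t \<in> UNIV - ?Z - cball 0 (max r 1)" by blast
    then have t: "t \<notin> X" "poly g t \<noteq> 0" "norm t > max r 1" by auto
    have "norm (poly q t) * norm (poly g t) \<le> (K + L * norm t) * norm (poly g t)"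
      using assms(2)[OF t(1)] unfolding q by (simp add: norm_mult)
    then have 1: "norm (poly q t) \<le> K + L * norm t" using t(2) by simp
    have "norm t * norm (poly q1 t) = norm (poly q t - a)" unfolding q1 by (simp add: norm_mult)
    also have "\<dots> \<le> norm (poly q t) + norm a" by (rule norm_triangle_ineq4)
    also have "\<dots> \<le> norm K + norm L * norm t + norm a"
      using 1 by (smt (verit) norm_ge_zero mult_right_mono real_norm_def)
    also have "\<dots> \<le> norm K * norm t + norm L * norm t + norm a * norm t"
      using t(3) by (intro add_mono mult_left_mono) (auto simp: mult_le_cancel_left1)
    also have "\<dots> = norm t * (norm K + norm L + norm a)" by (simp add: algebra_simps)
    finally have "norm (poly q1 t) \<le> norm K + norm L + norm a"
      by (rule mult_left_le_imp_le) (use t(3) in auto)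
    then show False using r[of t] t(3) by simp
  qed
  then show ?thesis using q q1 q2 by auto
qed

section \<open>Rank three Jordan algebras\<close>

locale jordan_alg =
  fixes s :: "complex \<Rightarrow> 'a::ab_group_add \<Rightarrow> 'a" and A :: "'a set"
    and mul :: "'a \<Rightarrow> 'a \<Rightarrow> 'a" (infixl "\<odot>" 70)
  assumes jordan: "jordan_algebra s A mul"

sublocale jordan_alg \<subseteq> fd_space s A
  using jordan by unfold_locales (auto simp: jordan_algebra_def vector_space_def)

context jordan_alg
begin

definition "e = unity A mul"

lemma mul_in [simp, intro]: "x \<in> A \<Longrightarrow> y \<in> A \<Longrightarrow> x \<odot> y \<in> A"
  using jordan unfolding jordan_algebra_def by blast

lemma mul_comm: "x \<in> A \<Longrightarrow> y \<in> A \<Longrightarrow> x \<odot> y = y \<odot> x"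
  using jordan unfolding jordan_algebra_def by blast

lemma mul_linear: "x \<in> A \<Longrightarrow> linear_map_on s A s (mul x)"
  using jordan unfolding jordan_algebra_def by blast

lemma jordan_identity: "x \<in> A \<Longrightarrow> y \<in> A \<Longrightarrow> x \<odot> x \<odot> (x \<odot> y) = x \<odot> (x \<odot> x \<odot> y)"
  using jordan unfolding jordan_algebra_def by blast

lemma unity_eqI: "is_unity A mul u \<Longrightarrow> unity A mul = u"
  unfolding unity_def
proof (rule the_equality)
  fix v assume "is_unity A mul u" "is_unity A mul v"
  then show "v = u" unfolding is_unity_def by metis
qed

lemma is_unity_e: "is_unity A mul e"
  using jordan unity_eqI unfolding jordan_algebra_def e_def by metis

lemma e_in [simp, intro]: "e \<in> A" and e_mul [simp]: "x \<in> A \<Longrightarrow> e \<odot> x = x" "x \<in> A \<Longrightarrow> x \<odot> e = x"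
  using is_unity_e unfolding is_unity_def by auto

lemma mul_add:
  "x \<in> A \<Longrightarrow> y \<in> A \<Longrightarrow> z \<in> A \<Longrightarrow> x \<odot> (y + z) = x \<odot> y + x \<odot> z"
  "x \<in> A \<Longrightarrow> y \<in> A \<Longrightarrow> z \<in> A \<Longrightarrow> (y + z) \<odot> x = y \<odot> x + z \<odot> x"
  using linear_map_onD(1)[OF mul_linear] by (simp_all add: mul_comm[of _ x])

lemma mul_scale:
  "x \<in> A \<Longrightarrow> y \<in> A \<Longrightarrow> x \<odot> s c y = s c (x \<odot> y)"
  "x \<in> A \<Longrightarrow> y \<in> A \<Longrightarrow> s c y \<odot> x = s c (y \<odot> x)"
  using linear_map_onD(2)[OF mul_linear] by (simp_all add: mul_comm[of _ x])

lemma pmap_mul: "pmap F \<Longrightarrow> pmap G \<Longrightarrow> pmap (\<lambda>x. F x \<odot> G x)"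
  by (rule pmap_bilinear) (auto intro!: linear_map_onI simp: mul_add mul_scale)

text \<open>Coefficient notation for polynomials of degree at most two in \<open>x\<close>; it turns
  computations in the algebra generated by \<open>x\<close> into polynomial identities between
  complex numbers.\<close>

definition comb :: "'a \<Rightarrow> complex \<Rightarrow> complex \<Rightarrow> complex \<Rightarrow> 'a" where
  "comb x a b c = s a e + s b x + s c (x \<odot> x)"

definition indep :: "'a \<Rightarrow> bool" where
  "indep x \<longleftrightarrow> (\<forall>a b c. comb x a b c = 0 \<longrightarrow> a = 0 \<and> b = 0 \<and> c = 0)"

text \<open>The generic equation at a single point, with numbers for \<open>T\<close>,
  \<open>S\<close>, \<open>N\<close>. The sign of \<open>S\<close> comes from solving the equation
  for the cube of \<open>x\<close>.\<close>

definition cubic :: "'a \<Rightarrow> complex \<Rightarrow> complex \<Rightarrow> complex \<Rightarrow> bool" where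
  "cubic x T S N \<longleftrightarrow> x \<odot> (x \<odot> x) = comb x N (- S) T"

lemma comb_in [simp, intro]: "x \<in> A \<Longrightarrow> comb x a b c \<in> A"
  unfolding comb_def by auto

lemma comb_add: "comb x a b c + comb x a' b' c' = comb x (a + a') (b + b') (c + c')"
  unfolding comb_def by (simp add: scale_left_distrib)

lemma comb_diff: "comb x a b c - comb x a' b' c' = comb x (a - a') (b - b') (c - c')"
  unfolding comb_def by (simp add: scale_left_diff_distrib)

lemma comb_scale: "s k (comb x a b c) = comb x (k * a) (k * b) (k * c)"
  unfolding comb_def by (simp add: scale_right_distrib)

lemma comb_0 [simp]: "comb x 0 0 0 = 0"
  and comb_e: "comb x 1 0 0 = e" and comb_x: "comb x 0 1 0 = x" and comb_sq: "comb x 0 0 1 = x \<odot> x"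
  unfolding comb_def by simp_all

lemma indepD: "indep x \<Longrightarrow> comb x a b c = 0 \<Longrightarrow> a = 0 \<and> b = 0 \<and> c = 0"
  unfolding indep_def by blast

lemma indep_eq: "indep x \<Longrightarrow> comb x a b c = comb x a' b' c' \<longleftrightarrow> a = a' \<and> b = b' \<and> c = c'"
  using indepD[of x "a - a'" "b - b'" "c - c'"] comb_diff[of x a b c a' b' c'] by auto

lemma cubic_unique:
  "indep x \<Longrightarrow> cubic x T S N \<Longrightarrow> cubic x T' S' N' \<Longrightarrow> T = T' \<and> S = S' \<and> N = N'"
  unfolding cubic_def using indep_eq by auto

lemma x_mul_comb:
  assumes "x \<in> A" "cubic x T S N"
  shows "x \<odot> comb x a b c = comb x (c * N) (a - c * S) (b + c * T)"
proof -
  have "x \<odot> comb x a b c = s a x + s b (x \<odot> x) + s c (comb x N (- S) T)"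
    using assms unfolding cubic_def by (simp add: comb_def[of x a b c] mul_add mul_scale)
  also have "\<dots> = comb x 0 a b + s c (comb x N (- S) T)" by (simp add: comb_def[of x 0])
  finally show ?thesis by (simp add: comb_scale comb_add)
qed

text \<open>The multiplication table of the quotient of the polynomial ring by X^3 - T X^2 + S X -
  N. The Jordan identity at \<open>y = x\<close> shows that on combinations of \<open>e\<close>,
  \<open>x\<close>, \<open>x \<odot> x\<close> multiplication by \<open>x \<odot> x\<close> is
  multiplication by \<open>x\<close> applied twice, so \<open>x_mul_comb\<close> suffices.\<close>

lemma mul_comb:
  assumes "x \<in> A" "cubic x T S N"
  shows "comb x a b c \<odot> comb x a' b' c' =
    comb x (a * a' + (b * c' + c * b') * N + c * c' * T * N)
      (a * b' + b * a' - (b * c' + c * b') * S + c * c' * (N - T * S))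
      (a * c' + c * a' + b * b' + (b * c' + c * b') * T + c * c' * (T^2 - S))"
proof -
  let ?y = "comb x a' b' c'"
  have "x \<odot> x \<odot> (x \<odot> x) = x \<odot> (x \<odot> (x \<odot> x))"
    using jordan_identity[of x x] assms by (simp add: mul_comm)
  then have sq: "x \<odot> x \<odot> ?y = x \<odot> (x \<odot> ?y)"
    using assms(1) by (simp add: comb_def mul_add mul_scale mul_comm[of "x \<odot> x" x])
  have "comb x a b c \<odot> ?y = s a ?y + s b (x \<odot> ?y) + s c (x \<odot> x \<odot> ?y)"
    using assms(1) by (simp add: comb_def[of x a b c] mul_add mul_scale)
  also have "\<dots> = s a ?y + s b (x \<odot> ?y) + s c (x \<odot> (x \<odot> ?y))" by (simp only: sq)
  also have "\<dots> = comb x (a * a' + (b * c' + c * b') * N + c * c' * T * N)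
      (a * b' + b * a' - (b * c' + c * b') * S + c * c' * (N - T * S))
      (a * c' + c * a' + b * b' + (b * c' + c * b') * T + c * c' * (T^2 - S))"
    unfolding x_mul_comb[OF assms] comb_scale comb_add
    by (rule arg_cong3[where f="comb x"]) (simp_all add: algebra_simps power2_eq_square)
  finally show ?thesis .
qed

section \<open>The subalgebra generated by the unity and one element\<close>

lemma in_span_insert_iff: "v \<in> span (insert a S) \<longleftrightarrow> (\<exists>k w. w \<in> span S \<and> v = s k a + w)"
  unfolding span_breakdown_eq by (metis add_diff_cancel_left' add.commute diff_add_cancel)

lemma span_eq_comb: "span {e, x, x \<odot> x} = {comb x a b c | a b c. True}"
proof -
  have "v \<in> span {e, x, x \<odot> x} \<longleftrightarrow> (\<exists>a b c. v = comb x a b c)" for v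
    unfolding in_span_insert_iff span_singleton comb_def by (auto simp: add.assoc)
  then show ?thesis by blast
qed

abbreviation "gen x \<equiv> generated_subalgebra s A mul {e, x}"

lemma gen_minimal: "subalgebra s A mul B \<Longrightarrow> e \<in> B \<Longrightarrow> x \<in> B \<Longrightarrow> gen x \<subseteq> B"
  unfolding generated_subalgebra_def by auto

lemma gen_subalgebra:
  assumes "x \<in> A" shows "subalgebra s A mul (gen x)" "e \<in> gen x" "x \<in> gen x"
proof -
  have "subalgebra s A mul A" unfolding subalgebra_def using subspace_V by auto
  then show "subalgebra s A mul (gen x)"
    unfolding generated_subalgebra_def subalgebra_def using assms
    by (auto intro!: subspace_Inter)
qed (auto simp: generated_subalgebra_def)

text \<open>Independence of a set does not see coincidences in its listing, so the cardinality is
  recorded as well.\<close>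

lemma independent_triple:
  assumes "indep x"
  shows "independent {e, x, x \<odot> x}" "card {e, x, x \<odot> x} = 3"
proof -
  have 1: "e \<noteq> 0" using indepD[OF assms, of 1 0 0] by (auto simp: comb_def)
  have 2: "x \<notin> span {e}"
  proof
    assume "x \<in> span {e}"
    then obtain a where "x = s a e" unfolding span_singleton by blast
    then have "comb x a (-1) 0 = 0" by (simp add: comb_def)
    then show False using indepD[OF assms] by fastforce
  qed
  have 3: "x \<odot> x \<notin> span {x, e}"
  proof
    assume "x \<odot> x \<in> span {x, e}"
    then obtain a b where "x \<odot> x - s b x = s a e"
      unfolding span_breakdown_eq[of _ x] span_singleton by blast
    then have "x \<odot> x = s a e + s b x" by (simp add: algebra_simps)
    then have "comb x a b (-1) = 0" by (simp add: comb_def)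
    then show False using indepD[OF assms] by fastforce
  qed
  have i1: "independent {e}" using 1 by simp
  have i2: "independent {x, e}" by (rule independent_insertI[OF 2 i1])
  have "independent {x \<odot> x, x, e}" by (rule independent_insertI[OF 3 i2])
  moreover have "{x \<odot> x, x, e} = {e, x, x \<odot> x}" by auto
  ultimately show "independent {e, x, x \<odot> x}" by simp
  have "x \<noteq> e" "x \<odot> x \<noteq> x" "x \<odot> x \<noteq> e" using 2 3 span_base by fastforce+
  then show "card {e, x, x \<odot> x} = 3" by simp
qed

text \<open>If the triple \<open>e\<close>, \<open>x\<close>, \<open>x \<odot> x\<close> is
  dependent, the span of \<open>e\<close> and \<open>x\<close> is already a subalgebra, of dimension
  at most two. If the cube of \<open>x\<close> lies outside the span of the triple, the generated
  subalgebra contains four independent vectors. Conversely, \<open>mul_comb\<close> closes the span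
  of the triple under products.\<close>

lemma dim_gen_eq_3_iff:
  assumes x: "x \<in> A"
  shows "dim (gen x) = 3 \<longleftrightarrow> indep x \<and> (\<exists>T S N. cubic x T S N)"
proof
  assume d: "dim (gen x) = 3"
  note g = gen_subalgebra[OF x]
  have i: "indep x"
  proof (rule ccontr)
    assume "\<not> indep x"
    then obtain a b c where abc: "comb x a b c = 0" "\<not> (a = 0 \<and> b = 0 \<and> c = 0)"
      unfolding indep_def by blast
    have sp: "v \<in> span {e, x} \<longleftrightarrow> (\<exists>a b. v = s a e + s b x)" for v
      unfolding in_span_insert_iff span_singleton by auto
    have ex: "e \<in> span {e, x}" "x \<in> span {e, x}" by (auto intro: span_base)
    \<comment> \<open>If \<open>c\<close> is nonzero, the relation is solved for the square.
      Otherwise either \<open>b\<close> is nonzero and \<open>x\<close> is a multiple of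
      \<open>e\<close>, or \<open>e\<close> itself is zero and so is \<open>x\<close>.\<close>
    have sq: "x \<odot> x \<in> span {e, x}"
    proof (cases "c = 0")
      case False
      have "s c (x \<odot> x) = - (s a e + s b x)"
        using abc(1) unfolding comb_def by (simp add: add_eq_0_iff)
      then have "s (1 / c) (s c (x \<odot> x)) \<in> span {e, x}"
        using ex by (auto intro!: span_scale span_neg span_add span_diff)
      then show ?thesis using False by simp
    next
      case c: True
      show ?thesis
      proof (cases "b = 0")
        case True
        then have "s a e = 0" "a \<noteq> 0" using abc c by (auto simp: comb_def)
        then have "e = 0" by simp
        then have "x = 0" using e_mul(1)[OF x] mul_scale(2)[of x x 0] x by simp
        then show ?thesis using mul_scale(2)[of x x 0] x span_zero by simp
      next
        case False
        have "s b x = - s a e" using abc(1) c unfolding comb_def by (simp add: add_eq_0_iff)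
        then have "s (1 / b) (s b x) = s (1 / b) (- s a e)" by simp
        then have xe: "x = s (- a / b) e" using False by simp
        have "x \<odot> x = s (- a / b) x" by (subst (1) xe) (use x in \<open>simp add: mul_scale del: scale_minus_left\<close>)
        then show ?thesis using ex by (auto intro!: span_neg span_scale)
      qed
    qed
    have "span {e, x} \<subseteq> A" by (rule span_minimal) (use x subspace_V in auto)
    moreover have "u \<odot> v \<in> span {e, x}" if uv: "u \<in> span {e, x}" "v \<in> span {e, x}" for u v
    proof -
      obtain a b a' b' where *: "u = s a e + s b x" "v = s a' e + s b' x"
        using uv sp by blast
      show ?thesis unfolding * using x
        by (simp add: mul_add mul_scale) (intro span_add span_scale ex sq)
    qed
    ultimately have "subalgebra s A mul (span {e, x})" unfolding subalgebra_def by blast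
    then have "gen x \<subseteq> span {e, x}" using gen_minimal ex by blast
    then have "dim (gen x) \<le> card {e, x}" by (intro dim_le_card) auto
    moreover have "card {e, x} \<le> 2" by (simp add: card_insert_if)
    ultimately show False using d by simp
  qed
  moreover have "x \<odot> (x \<odot> x) \<in> span {e, x, x \<odot> x}"
  proof (rule ccontr)
    assume n: "x \<odot> (x \<odot> x) \<notin> span {e, x, x \<odot> x}"
    let ?B = "insert (x \<odot> (x \<odot> x)) {e, x, x \<odot> x}"
    have ind: "independent ?B" by (rule independent_insertI[OF n independent_triple(1)[OF i]])
    have "x \<odot> (x \<odot> x) \<notin> {e, x, x \<odot> x}" by (metis n span_base)
    then have card: "card ?B = 4" using independent_triple(2)[OF i]
      by (subst card_insert_disjoint) auto
    have cl: "u \<odot> v \<in> gen x" if "u \<in> gen x" "v \<in> gen x" for u v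
      using g(1) that unfolding subalgebra_def by blast
    have "?B \<subseteq> gen x" by (simp add: g cl)
    obtain C where C: "C \<subseteq> gen x" "independent C" "gen x \<subseteq> span C" "card C = dim (gen x)"
      using basis_exists by blast
    have "card C \<noteq> 0" using C(4) d by simp
    then have "finite C" by (rule card_ge_0_finite[OF neq0_conv[THEN iffD1]])
    then have "card ?B \<le> card C"
      using independent_span_bound[of C ?B] ind C \<open>?B \<subseteq> gen x\<close> by blast
    then show False using card C d by simp
  qed
  then obtain N S T where "x \<odot> (x \<odot> x) = comb x N S T" unfolding span_eq_comb by blast
  then have "cubic x T (- S) N" unfolding cubic_def by simp
  then have "\<exists>T S N. cubic x T S N" by blast
  ultimately show "indep x \<and> (\<exists>T S N. cubic x T S N)" by simp
next
  assume "indep x \<and> (\<exists>T S N. cubic x T S N)"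
  then obtain T S N where i: "indep x" and c: "cubic x T S N" by blast
  note g = gen_subalgebra[OF x]
  have "subalgebra s A mul (span {e, x, x \<odot> x})"
    unfolding subalgebra_def
  proof (intro conjI ballI)
    show "span {e, x, x \<odot> x} \<subseteq> A" by (rule span_minimal) (use x subspace_V in auto)
    show "u \<odot> v \<in> span {e, x, x \<odot> x}" if "u \<in> span {e, x, x \<odot> x}" "v \<in> span {e, x, x \<odot> x}" for u v
      using that unfolding span_eq_comb by (auto simp: mul_comb[OF x c]) blast
  qed (rule subspace_span)
  then have "gen x \<subseteq> span {e, x, x \<odot> x}" by (rule gen_minimal) (auto intro: span_base)
  moreover have "span {e, x, x \<odot> x} \<subseteq> gen x"
    using g unfolding subalgebra_def by (intro span_minimal) auto
  ultimately have "gen x = span {e, x, x \<odot> x}" by simp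
  then show "dim (gen x) = 3"
    using independent_triple[OF i] dim_span_eq_card_independent by metis
qed

lemma has_rank_3_iff:
  "has_rank s A mul 3 \<longleftrightarrow> generic (\<lambda>x. indep x \<and> (\<exists>T S N. cubic x T S N))"
proof -
  have "generic (\<lambda>x. dim (gen x) = 3) \<longleftrightarrow> generic (\<lambda>x. indep x \<and> (\<exists>T S N. cubic x T S N))"
    by (rule iffI; erule generic_mono) (simp_all add: dim_gen_eq_3_iff)
  then show ?thesis unfolding has_rank_def e_def .
qed

lemma exists_functional:
  assumes "indep x"
  shows "\<exists>l. functional l \<and> l e = a \<and> l x = b \<and> l (x \<odot> x) = c"
proof -
  interpret P: vector_space_pair s "(*) :: complex \<Rightarrow> complex \<Rightarrow> complex"
    by unfold_locales (simp_all add: algebra_simps)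
  note ind = independent_triple[OF assms]
  have ne: "x \<noteq> e" "x \<odot> x \<noteq> x" "x \<odot> x \<noteq> e"
    using ind(2) by (auto simp: card_insert_if split: if_splits)
  let ?f = "\<lambda>v. if v = e then a else if v = x then b else c"
  obtain g where g: "Vector_Spaces.linear s (*) g" "\<forall>v\<in>{e, x, x \<odot> x}. g v = ?f v"
    using P.linear_independent_extend[OF ind(1), of ?f] by blast
  interpret g: Vector_Spaces.linear s "(*)" g by (rule g(1))
  have "functional g" by (rule linear_map_onI) (simp_all add: g.add g.scale)
  then show ?thesis using g(2) ne by auto
qed

section \<open>Cubic equations of polynomial expressions in one element\<close>

lemma comb_comb:
  assumes "x \<in> A" "cubic x T S N"
  shows "comb (comb x p q r) a b c =
    comb x (a + b * p + c * (p * p + (q * r + r * q) * N + r * r * T * N))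
      (b * q + c * (p * q + q * p - (q * r + r * q) * S + r * r * (N - T * S)))
      (b * r + c * (p * r + r * p + q * q + (q * r + r * q) * T + r * r * (T^2 - S)))"
proof -
  have "comb (comb x p q r) a b c =
      s a (comb x 1 0 0) + s b (comb x p q r) + s c (comb x p q r \<odot> comb x p q r)"
    unfolding comb_e by (simp only: comb_def[of "comb x p q r"])
  then show ?thesis unfolding mul_comb[OF assms] comb_scale comb_add by simp
qed

text \<open>The last three hypotheses compare the coefficients of \<open>e\<close>, \<open>x\<close>
  and \<open>x \<odot> x\<close> on the two sides of the cubic equation of \<open>y\<close>, so that
  an instance is settled by ring identities.\<close>

lemma cubic_combI:
  assumes "x \<in> A" "cubic x T S N" "y = comb x p q r"
    "y \<odot> y = comb x p' q' r'"
    "p * p' + (q * r' + r * q') * N + r * r' * T * N = N1 - S1 * p + T1 * p'"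
    "p * q' + q * p' - (q * r' + r * q') * S + r * r' * (N - T * S) = - S1 * q + T1 * q'"
    "p * r' + r * p' + q * q' + (q * r' + r * q') * T + r * r' * (T^2 - S) = - S1 * r + T1 * r'"
  shows "cubic y T1 S1 N1"
proof -
  have "comb y N1 (- S1) T1 =
      s N1 (comb x 1 0 0) + s (- S1) (comb x p q r) + s T1 (comb x p' q' r')"
    by (simp only: comb_e assms(3)[symmetric] assms(4)[symmetric] comb_def[of y])
  also have "\<dots> = comb x (N1 - S1 * p + T1 * p') (- S1 * q + T1 * q') (- S1 * r + T1 * r')"
    unfolding comb_scale comb_add by simp
  also have "\<dots> = y \<odot> (y \<odot> y)"
    unfolding assms(4) unfolding assms(3) mul_comb[OF assms(1,2)] assms(5-7) ..
  finally show ?thesis unfolding cubic_def by simp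
qed

text \<open>If the cubic of \<open>x\<close> has roots \<lambda>, that of \<open>e + s t x\<close>
  has roots 1 + t \<lambda>; the coefficients are their elementary symmetric functions. Independence
  survives because the change of powers is triangular with diagonal 1, t, t^2.\<close>

lemma shift_e:
  assumes x: "x \<in> A" "cubic x T S N" and ind: "indep x" and t: "t \<noteq> 0"
  shows "indep (e + s t x)"
    and "cubic (e + s t x) (3 + t * T) (3 + 2 * t * T + t^2 * S) (1 + t * T + t^2 * S + t^3 * N)"
proof -
  have y: "e + s t x = comb x 1 t 0" unfolding comb_def by simp
  have "comb x 1 t 0 \<odot> comb x 1 t 0 = comb x 1 (2 * t) (t^2)"
    unfolding mul_comb[OF x] by (simp add: power2_eq_square)
  then have sq: "(e + s t x) \<odot> (e + s t x) = comb x 1 (2 * t) (t^2)" unfolding y .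
  show "indep (e + s t x)" unfolding indep_def
  proof (intro allI impI)
    fix a b c assume "comb (e + s t x) a b c = 0"
    then have "a + b + c = 0" "b * t + 2 * c * t = 0" "c * t^2 = 0"
      unfolding y comb_comb[OF x] using indepD[OF ind] by (fastforce simp: power2_eq_square algebra_simps)+
    then show "a = 0 \<and> b = 0 \<and> c = 0" using t by auto
  qed
  show "cubic (e + s t x) (3 + t * T) (3 + 2 * t * T + t^2 * S) (1 + t * T + t^2 * S + t^3 * N)"
    by (rule cubic_combI[OF x y sq]) algebra+
qed

text \<open>The coefficients are the elementary symmetric functions of the squared roots. The first
  of them later expresses \<open>S\<close> through the trace.\<close>

lemma square_generic:
  assumes x: "x \<in> A" "cubic x T S N"
  shows "cubic (x \<odot> x) (T^2 - 2 * S) (S^2 - 2 * N * T) (N^2)"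
proof (rule cubic_combI[OF x, of "x \<odot> x" 0 0 1 "T * N" "N - T * S" "T^2 - S"])
  have "comb x 0 0 1 \<odot> comb x 0 0 1 = comb x (T * N) (N - T * S) (T^2 - S)"
    unfolding mul_comb[OF x] by simp
  then show "x \<odot> x \<odot> (x \<odot> x) = comb x (T * N) (N - T * S) (T^2 - S)"
    unfolding comb_sq .
qed (simp add: comb_sq, algebra+)

text \<open>The roots belonging to the adjoint \<open>y\<close> are the pairwise products of the
  roots of \<open>x\<close>, so its coefficients are \<open>S\<close>, \<open>N * T\<close>,
  \<open>N^2\<close>. With these, the last claim computes the adjoint of the adjoint.\<close>

lemma adjoint_generic:
  fixes T S N
  assumes x: "x \<in> A" "cubic x T S N" and ind: "indep x" and N: "N \<noteq> 0"
  defines "y \<equiv> comb x S (- T) 1"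
  shows "indep y" "cubic y S (N * T) (N^2)" "comb y (N * T) (- S) 1 = s N x"
proof -
  have "comb x S (- T) 1 \<odot> comb x S (- T) 1 = comb x (S^2 - T * N) (N - T * S) S"
    unfolding mul_comb[OF x]
    by (rule arg_cong3[where f="comb x"]) (simp_all add: algebra_simps power2_eq_square)
  then have sq: "y \<odot> y = comb x (S^2 - T * N) (N - T * S) S" unfolding y_def .
  have y: "y = comb x S (- T) 1" by (simp add: y_def)
  have comb_y: "comb y a b c = comb x (a + b * S + c * (S^2 - T * N)) (c * (N - T * S) - b * T) (b + c * S)"
    for a b c
    unfolding y comb_comb[OF x] by (rule arg_cong3[where f="comb x"]) algebra+
  show "indep y" unfolding indep_def
  proof (intro allI impI)
    fix a b c assume "comb y a b c = 0"
    then have 1: "a + b * S + c * (S^2 - T * N) = 0" "c * (N - T * S) - b * T = 0" "b + c * S = 0"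
      unfolding comb_y using indepD[OF ind] by blast+
    \<comment> \<open>Eliminating \<open>b\<close> from the last two equations leaves
      \<open>c * N\<close>, so \<open>N \<noteq> 0\<close> keeps the powers of \<open>y\<close>
      independent.\<close>
    then have "c * N = 0" by algebra
    with N 1 show "a = 0 \<and> b = 0 \<and> c = 0" by simp
  qed
  show "cubic y S (N * T) (N^2)" by (rule cubic_combI[OF x y sq]) algebra+
  have "comb y (N * T) (- S) 1 = comb x 0 N 0"
    unfolding y comb_comb[OF x]
    by (rule arg_cong3[where f="comb x"]) (simp_all add: algebra_simps power2_eq_square)
  then show "comb y (N * T) (- S) 1 = s N x" by (simp add: comb_def)
qed

lemma generic_cubic_equation_cubic:
  "generic_cubic_equation s A mul T S N \<Longrightarrow> x \<in> A \<Longrightarrow> cubic x (T x) (S x) (N x)"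
  unfolding generic_cubic_equation_def cubic_def comb_def e_def[symmetric]
  by (auto simp: algebra_simps eq_neg_iff_add_eq_0)

lemma jordan_adjoint_eq: "jordan_adjoint s A mul T S x = comb x (S x) (- T x) 1"
  unfolding jordan_adjoint_def comb_def e_def[symmetric] by (simp add: algebra_simps)

end

section \<open>The adjoint as a quadro-quadric Cremona involution\<close>

locale rank3_alg = jordan_alg +
  assumes rank3: "has_rank s A mul 3"
begin

lemma generic_indep: "generic indep"
  by (rule generic_mono[OF rank3[unfolded has_rank_3_iff]]) simp

context
  fixes T S N
  assumes gce: "generic_cubic_equation s A mul T S N"
begin

lemma cubic_TSN: "x \<in> A \<Longrightarrow> cubic x (T x) (S x) (N x)"
  by (rule generic_cubic_equation_cubic[OF gce])

lemma TSN_unique: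
  assumes "x \<in> A" "indep x" "cubic x T' S' N'"
  shows "T x = T'" "S x = S'" "N x = N'"
  using cubic_unique[OF assms(2) cubic_TSN[OF assms(1)] assms(3)] by auto

lemma pfun_TSN: "pfun T" "pfun S" "pfun N"
  using gce unfolding generic_cubic_equation_def form_on_def by auto

lemma TSN_shift:
  assumes x: "x \<in> A" and ind: "indep x" and t: "t \<noteq> 0"
  shows "T (e + s t x) = 3 + t * T x" "S (e + s t x) = 3 + 2 * t * T x + t^2 * S x"
    "N (e + s t x) = 1 + t * T x + t^2 * S x + t^3 * N x"
  using TSN_unique[OF _ shift_e[OF x cubic_TSN[OF x] ind t]] x by auto

text \<open>On the line \<open>e + s t x\<close> the norm is a polynomial in \<open>t\<close> with
  constant term 1, hence nonzero for some \<open>t\<close>. The value \<open>t = 0\<close> is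
  avoided because \<open>TSN_shift\<close> is stated for nonzero \<open>t\<close>.\<close>

lemma generic_N: "generic (\<lambda>x. N x \<noteq> 0)"
proof -
  obtain x where x: "x \<in> A" "indep x" using generic_ex[OF generic_indep] by blast
  define p where "p = [:1, T x, S x, N x:]"
  have "p \<noteq> 0" unfolding p_def by simp
  then obtain t where t: "t \<notin> {0}" "poly p t \<noteq> 0" using poly_nonroot by blast
  have "N (e + s t x) = poly p t"
    using TSN_shift(3)[OF x, of t] t unfolding p_def by (simp add: algebra_simps power2_eq_square power3_eq_cube)
  then show ?thesis using t x generic_nonzero[OF pfun_TSN(3), of "e + s t x"] by auto
qed

abbreviation "adj \<equiv> jordan_adjoint s A mul T S"

lemma quadratic_adj: "quadratic_map_on s A adj"
  unfolding quadratic_map_on_def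
proof (intro conjI ballI allI impI)
  show "adj x \<in> A" if "x \<in> A" for x using that by (simp add: jordan_adjoint_eq)
  fix l assume l: "functional l"
  have "pmap adj"
    unfolding jordan_adjoint_def e_def[symmetric]
    by (intro pmap_intros pmap_mul pfun_TSN e_in)
  then have "pfun (\<lambda>x. l (adj x))" using l by (rule pmapD)
  moreover have "adj (s c x) = s (c^2) (adj x)" if "x \<in> A" for c x
    using gce that unfolding generic_cubic_equation_def form_on_def
    unfolding jordan_adjoint_eq comb_def
    by (simp add: mul_scale scale_right_distrib scale_right_diff_distrib power2_eq_square ac_simps)
  ultimately show "form_on s A 2 (\<lambda>x. l (adj x))"
    unfolding form_on_def using linear_map_onD(2)[OF l] by (simp add: jordan_adjoint_eq)
qed

text \<open>The adjoint is again independent and satisfies the cubic of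
  \<open>adjoint_generic\<close>, so uniqueness of the coefficients determines \<open>T\<close> and
  \<open>S\<close> at it.\<close>

lemma adj_adj: 
  assumes x: "x \<in> A" "indep x" "N x \<noteq> 0"
  shows "adj (adj x) = s (N x) x"
proof -
  note y = adjoint_generic[OF x(1) cubic_TSN[OF x(1)] x(2,3)]
  have "T (adj x) = S x" "S (adj x) = N x * T x"
    unfolding jordan_adjoint_eq[of _ _ x] using TSN_unique[OF _ y(1,2)] x by auto
  then show ?thesis using y(3) by (simp add: jordan_adjoint_eq)
qed

lemma proj_left_inverse_adj: "proj_left_inverse_on s A adj adj"
  unfolding proj_left_inverse_on_def
proof (rule generic_mono[OF generic_conj[OF generic_indep generic_N]])
  fix x assume x: "x \<in> A" "indep x \<and> N x \<noteq> 0"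
  have "adj x \<noteq> 0" using indepD[of x "S x" "- T x" 1] x by (auto simp: jordan_adjoint_eq)
  then show "adj x \<noteq> 0 \<and> (\<exists>c. c \<noteq> 0 \<and> adj (adj x) = s c x)" using adj_adj x by blast
qed

text \<open>Along the line \<open>e + t y\<close> a suitable linear functional of the adjoint is constantly \<open>1\<close>, so
  a common factor restricts to a unit of \<open>\<complex>[t]\<close> there.\<close>

lemma no_common_factor_adj: "no_common_factor_on s A adj"
  unfolding no_common_factor_on_def
proof (intro allI impI, elim conjE)
  fix h assume h: "pfun h" and fac:
    "\<forall>l. functional l \<longrightarrow> (\<exists>g. pfun g \<and> (\<forall>x\<in>A. l (adj x) = h x * g x))"
  have const: "h (e + y) = h e" if y: "y \<in> A" "indep y" for y
  proof -
    \<comment> \<open>The three values are chosen so that in \<open>l (adj (e + s t y))\<close> the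
      constant term is 1 and the coefficients of \<open>t\<close> and \<open>t^2\<close>
      vanish.\<close>
    obtain l where l: "functional l" "l e = 1" "l y = T y" "l (y \<odot> y) = (T y)^2 - S y"
      using exists_functional[OF y(2)] by blast
    obtain g where g: "pfun g" "\<forall>x\<in>A. l (adj x) = h x * g x" using fac l(1) by blast
    obtain p where p: "\<forall>t. h (e + s t y) = poly p t" using pfun_line[OF h e_in y(1)] by blast
    obtain q where q: "\<forall>t. g (e + s t y) = poly q t" using pfun_line[OF g(1) e_in y(1)] by blast
    have l1: "l (adj (e + s t y)) = 1" if t: "t \<noteq> 0" for t
    proof -
      have et: "e + s t y = comb y 1 t 0" by (simp add: comb_def)
      have "adj (e + s t y) = comb y (1 + t * T y + t^2 * S y) (- t - t^2 * T y) (t^2)"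
        unfolding jordan_adjoint_eq TSN_shift[OF y t]
        unfolding et comb_comb[OF y(1) cubic_TSN[OF y(1)]] 
        by (rule arg_cong3[where f="comb y"]) algebra+
      then have "l (adj (e + s t y)) =
          (1 + t * T y + t^2 * S y) + (- t - t^2 * T y) * T y + t^2 * ((T y)^2 - S y)"
        using y(1) l unfolding comb_def by (simp add: linear_map_onD[OF l(1)])
      also have "\<dots> = 1" by algebra
      finally show ?thesis .
    qed
    have "p * q = 1"
      by (rule poly_eq_cofinite[of "{0}"]) (use l1 g(2) p q y(1) in auto)
    then have "degree p = 0" by (metis dvd_triv_left is_unit_iff_degree one_neq_zero mult_zero_left)
    then have "poly p 1 = poly p 0" by (metis degree_0_id poly_const_conv)
    then show ?thesis using p[rule_format, of 1] p[rule_format, of 0] by simp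
  qed
  \<comment> \<open>A general \<open>z\<close> has the form \<open>e + y\<close> with
    \<open>y\<close> independent, so \<open>h\<close> is generically constant and therefore
    constant.\<close>
  have "generic (\<lambda>z. indep (- e + z))" by (rule generic_translate[OF generic_indep]) simp
  then have "generic (\<lambda>z. h z = h e)"
    by (rule generic_mono) (use const[of "- e + z" for z] in \<open>metis add_minus_cancel e_in in_V(2,5)\<close>)
  then show "\<exists>c. \<forall>x\<in>A. h x = c"
    using pfun_eq_generic[OF h poly_fun_on.const] by blast
qed

theorem quadro_quadric_adjoint:
  assumes "dim A = m + 1"
  shows "quadro_quadric_cremona s A m adj"
  unfolding quadro_quadric_cremona_def
  using vector_space_axioms subspace_V finite_dim_V assms quadratic_adj no_common_factor_adj
    proj_left_inverse_adj by blast

end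
end

section \<open>Existence of the generic cubic equation\<close>

text \<open>\<open>T\<close> is the sum of the three roots with multiplicity, so bounds on the roots
  bound \<open>T\<close>. The second root is taken from the quotient of the cubic by X - u, and the
  third is what remains of \<open>T\<close>.\<close>

lemma cubic_root_sum:
  fixes T S N :: complex
  obtains u v w where "T = u + v + w"
    "\<And>z. z \<in> {u, v, w} \<Longrightarrow> z^3 - T * z^2 + S * z - N = 0"
proof -
  have "\<not> constant (poly [:-N, S, -T, 1:])" by (subst constant_degree) simp
  then obtain u where u: "poly [:-N, S, -T, 1:] u = 0" using fundamental_theorem_of_algebra by blast
  have "\<not> constant (poly [:u^2 - T * u + S, u - T, 1:])" by (subst constant_degree) simp
  then obtain v where v: "poly [:u^2 - T * u + S, u - T, 1:] v = 0"
    using fundamental_theorem_of_algebra by blast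
  have u': "u^3 - T * u^2 + S * u - N = 0"
    using u by (simp add: algebra_simps power2_eq_square power3_eq_cube)
  have v': "v^2 + (u - T) * v + (u^2 - T * u + S) = 0"
    using v by (simp add: algebra_simps power2_eq_square)
  have "v^3 - T * v^2 + S * v - N = 0" using u' v' by algebra
  moreover have "(T - u - v)^3 - T * (T - u - v)^2 + S * (T - u - v) - N = 0" using u' v' by algebra
  ultimately show ?thesis using that[of u v "T - u - v"] u' by auto
qed

section \<open>Extending generically additive functions to linear functionals\<close>

context fd_space
begin

text \<open>The extension is \<open>f (x + z) - f z\<close> for any \<open>z\<close> such that both
  terms lie in the open set \<open>U\<close>. Two choices of \<open>z\<close> agree because both can
  be compared with a common \<open>w\<close> in general position.\<close>

lemma functional_of_generically_additive:
  assumes U: "generic U"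
    and U_scale: "\<And>c x. x \<in> V \<Longrightarrow> U x \<Longrightarrow> c \<noteq> 0 \<Longrightarrow> U (s c x)"
    and add: "\<And>x y. x \<in> V \<Longrightarrow> y \<in> V \<Longrightarrow> U x \<Longrightarrow> U y \<Longrightarrow> U (x + y) \<Longrightarrow> f (x + y) = f x + f y"
    and scale: "\<And>c x. x \<in> V \<Longrightarrow> U x \<Longrightarrow> c \<noteq> 0 \<Longrightarrow> f (s c x) = c * f x"
  shows "\<exists>l. functional l \<and> (\<forall>x\<in>V. U x \<longrightarrow> l x = f x)"
proof -
  define R where "R x z \<longleftrightarrow> z \<in> V \<and> U z \<and> U (x + z)" for x z
  define l where "l x = (let z = SOME z. R x z in f (x + z) - f z)" for x
  have R_ex: "\<exists>z. R x z" if "x \<in> V" for x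
    unfolding R_def using generic_ex[OF generic_conj[OF U generic_translate[OF U that]]] by blast
  have indep: "f (x + z) - f z = f (x + z') - f z'" if x: "x \<in> V" and R: "R x z" "R x z'" for x z z'
  proof -
    have z: "z \<in> V" "z' \<in> V" "x + z \<in> V" "x + z' \<in> V" using R x by (auto simp: R_def)
    obtain w where w: "w \<in> V" "U w" "U (x + w)" "U (z + w)" "U (z' + w)" "U (x + z + w)" "U (x + z' + w)"
      using generic_ex[OF generic_conj[OF U generic_conj[OF generic_translate[OF U x]
        generic_conj[OF generic_translate[OF U z(1)] generic_conj[OF generic_translate[OF U z(2)]
        generic_conj[OF generic_translate[OF U z(3)] generic_translate[OF U z(4)]]]]]]] by blast
    have "f (x + z) - f z = f (x + w) - f w" if "R x z" "U (x + z + w)" for z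
    proof -
      have "f (x + z) + f w = f (x + z + w)"
        by (rule add[symmetric]) (use that w x in \<open>auto simp: R_def\<close>)
      moreover have "f (x + w) + f z = f (x + w + z)"
        by (rule add[symmetric]) (use that w x in \<open>auto simp: R_def ac_simps\<close>)
      ultimately show ?thesis by (simp add: algebra_simps)
    qed
    from this[of z] this[of z'] show ?thesis using w R by simp
  qed
  have l_eq: "l x = f (x + z) - f z" if "x \<in> V" "R x z" for x z
    unfolding l_def Let_def using indep[OF that(1) _ that(2)] someI_ex[OF R_ex[OF that(1)]] by blast
  have "functional l"
  proof (rule linear_map_onI)
    fix x y assume xy: "x \<in> V" "y \<in> V"
    obtain z where z: "R x z" using R_ex xy by blast
    then have z': "z \<in> V" "x + z \<in> V" "x + z + y \<in> V" using xy by (auto simp: R_def)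
    obtain w where w: "w \<in> V" "U w" "U (y + w)" "U (z + w)" "U (x + z + y + w)"
      using generic_ex[OF generic_conj[OF U generic_conj[OF generic_translate[OF U xy(2)]
        generic_conj[OF generic_translate[OF U z'(1)] generic_translate[OF U z'(3)]]]]] by blast
    \<comment> \<open>Reading \<open>l (x + y)\<close> at the base point \<open>z + w\<close> allows
      a regrouping into the base point \<open>z\<close> for \<open>x\<close> and \<open>w\<close>
      for \<open>y\<close>.\<close>
    have "l (x + y) = f (x + y + (z + w)) - f (z + w)"
      by (rule l_eq) (use xy z w in \<open>auto simp: R_def ac_simps\<close>)
    also have "x + y + (z + w) = (x + z) + (y + w)" by (simp add: ac_simps)
    also have "f \<dots> = f (x + z) + f (y + w)"
      by (rule add) (use xy z w in \<open>auto simp: R_def ac_simps\<close>)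
    also have "f (z + w) = f z + f w" by (rule add) (use xy z w in \<open>auto simp: R_def\<close>)
    finally have "l (x + y) = f (x + z) - f z + (f (y + w) - f w)" by simp
    also have "\<dots> = l x + l y" using l_eq[of x z] l_eq[of y w] xy z w by (auto simp: R_def)
    finally show "l (x + y) = l x + l y" .
  next
    fix c x assume x: "x \<in> V"
    obtain z where z: "R x z" using R_ex x by blast
    show "l (s c x) = c * l x"
    \<comment> \<open>Homogeneity of \<open>f\<close> is given for nonzero scalars; at zero the
      defining difference is \<open>f w - f w\<close>.\<close>
    proof (cases "c = 0")
      case True
      obtain w where "R 0 w" using R_ex by blast
      then show ?thesis using True l_eq[of 0 w] by simp
    next
      case False
      have sc: "s c x + s c z = s c (x + z)" by (simp add: scale_right_distrib)
      have "R (s c x) (s c z)" using z False x by (auto simp: R_def sc intro!: U_scale)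
      then have "l (s c x) = f (s c (x + z)) - f (s c z)" using l_eq x unfolding sc[symmetric] by simp
      also have "\<dots> = c * (f (x + z) - f z)"
        using z x False by (simp add: R_def scale right_diff_distrib)
      also have "\<dots> = c * l x" using l_eq x z by simp
      finally show ?thesis .
    qed
  qed
  moreover have "l x = f x" if x: "x \<in> V" "U x" for x
  proof -
    obtain z where "R x z" using R_ex x by blast
    then show ?thesis using l_eq[of x z] add[of x z] x by (simp add: R_def)
  qed
  ultimately show ?thesis by blast
qed

end

section \<open>Eigenvalues of multiplication operators\<close>

context jordan_alg
begin

text \<open>The eigenvector is the quotient of the cubic by X - l, evaluated at \<open>x\<close>.
  Its coefficient of \<open>x \<odot> x\<close> is 1, so it is nonzero.\<close>

lemma eigenvalue_of_cubic_root:
  assumes x: "x \<in> A" "cubic x T S N" "indep x" and l: "l^3 - T * l^2 + S * l - N = 0"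
  shows "\<exists>w\<in>A. w \<noteq> 0 \<and> x \<odot> w = s l w"
proof (intro bexI conjI)
  let ?w = "comb x (l^2 - T * l + S) (l - T) 1"
  show "?w \<noteq> 0" using indepD[OF x(3)] by fastforce
  show "x \<odot> ?w = s l ?w" unfolding x_mul_comb[OF x(1,2)] comb_scale
    by (rule arg_cong3[where f="comb x"]) (use l in algebra)+
qed (use x in auto)

text \<open>An eigenvalue is bounded by an operator norm, and the norm of multiplication by
  \<open>a + s t b\<close> grows at most linearly in \<open>norm t\<close>.\<close>

lemma eigenvalue_bound_on_line:
  assumes a: "a \<in> A" and b: "b \<in> A"
  obtains K L where "\<And>t w l. w \<in> A \<Longrightarrow> w \<noteq> 0 \<Longrightarrow> (a + s t b) \<odot> w = s l w \<Longrightarrow> norm l \<le> K + L * norm t"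
proof -
  obtain B c where B: "finite B" "B \<subseteq> A" "\<And>b. functional (c b)" 
    "\<And>x. x \<in> A \<Longrightarrow> x = (\<Sum>b\<in>B. s (c b x) b)" by (rule coordinates) blast
  define n where "n w = (\<Sum>b\<in>B. norm (c b w))" for w
  have n_pos: "n w > 0" if "w \<in> A" "w \<noteq> 0" for w
  proof -
    have "\<exists>b\<in>B. c b w \<noteq> 0"
      using B(4)[OF that(1)] that(2) by (metis (mono_tags, lifting) scale_zero_left sum.neutral)
    then show ?thesis unfolding n_def by (metis B(1) norm_ge_zero sum_pos2 zero_less_norm_iff)
  qed
  have n_add: "n (v + w) \<le> n v + n w" if "v \<in> A" "w \<in> A" for v w
    unfolding n_def sum.distrib[symmetric]
    by (intro sum_mono) (use that in \<open>simp add: linear_map_onD(1)[OF B(3)] norm_triangle_ineq\<close>)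
  have n_scale: "n (s t w) = norm t * n w" if "w \<in> A" for t w
    unfolding n_def using that
    by (simp add: linear_map_onD(2)[OF B(3)] norm_mult sum_distrib_left)
  \<comment> \<open>The sum of the absolute values of all matrix entries of multiplication by
    \<open>x\<close>, which dominates the operator norm for \<open>n\<close>.\<close>
  define K where "K x = (\<Sum>b'\<in>B. \<Sum>b\<in>B. norm (c b' (x \<odot> b)))" for x
  have n_mul: "n (x \<odot> w) \<le> K x * n w" if x: "x \<in> A" and w: "w \<in> A" for x w
  proof -
    have "norm (c b' (x \<odot> w)) \<le> (\<Sum>b\<in>B. norm (c b' (x \<odot> b))) * n w" for b'
    proof -
      have fl: "functional (\<lambda>w. c b' (x \<odot> w))"
        by (rule linear_map_onI) (simp_all add: x mul_add mul_scale linear_map_onD[OF B(3)])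
      have "c b' (x \<odot> w) = c b' (x \<odot> (\<Sum>b\<in>B. s (c b w) b))" using B(4)[OF w] by simp
      also have "\<dots> = (\<Sum>b\<in>B. c b' (x \<odot> s (c b w) b))"
        by (rule functional_sum[OF fl]) (use B(2) in auto)
      also have "\<dots> = (\<Sum>b\<in>B. c b w * c b' (x \<odot> b))"
        by (rule sum.cong) (use B(2) linear_map_onD(2)[OF fl] in auto)
      also have "norm \<dots> \<le> (\<Sum>b\<in>B. norm (c b w * c b' (x \<odot> b)))" by (rule norm_sum)
      also have "\<dots> \<le> (\<Sum>b\<in>B. norm (c b' (x \<odot> b)) * n w)"
      proof (rule sum_mono)
        fix b assume b: "b \<in> B"
        have "norm (c b w) \<le> n w" unfolding n_def by (rule member_le_sum[OF b]) (use B(1) in auto)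
        then have "norm (c b w) * norm (c b' (x \<odot> b)) \<le> n w * norm (c b' (x \<odot> b))"
          by (rule mult_right_mono) simp
        then show "norm (c b w * c b' (x \<odot> b)) \<le> norm (c b' (x \<odot> b)) * n w"
          by (simp add: norm_mult mult.commute)
      qed
      finally show ?thesis by (simp add: sum_distrib_right)
    qed
    then have "n (x \<odot> w) \<le> (\<Sum>b'\<in>B. (\<Sum>b\<in>B. norm (c b' (x \<odot> b))) * n w)"
      unfolding n_def[of "x \<odot> w"] by (intro sum_mono)
    then show ?thesis unfolding K_def by (simp add: sum_distrib_right)
  qed
  show ?thesis
  proof (rule that[of "K a" "K b"])
    fix t w l assume w: "w \<in> A" "w \<noteq> 0" and ev: "(a + s t b) \<odot> w = s l w"
    have "norm l * n w = n ((a + s t b) \<odot> w)" using n_scale w ev by simp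
    also have "(a + s t b) \<odot> w = a \<odot> w + s t (b \<odot> w)"
      using a b w by (simp add: mul_add mul_scale)
    also have "n \<dots> \<le> n (a \<odot> w) + n (s t (b \<odot> w))" by (rule n_add) (use a b w in auto)
    also have "\<dots> = n (a \<odot> w) + norm t * n (b \<odot> w)" using n_scale b w by simp
    also have "\<dots> \<le> K a * n w + norm t * (K b * n w)"
      using n_mul a b w by (intro add_mono mult_left_mono) auto
    also have "\<dots> = (K a + K b * norm t) * n w" by (simp add: algebra_simps)
    finally show "norm l \<le> K a + K b * norm t" using n_pos[OF w] by simp
  qed
qed

end

section \<open>Rationality and linearity of the trace, and the generic equation\<close>

context rank3_alg
begin

lemma square_shift:
  assumes y: "y \<in> A"
  shows "(e + s k y) \<odot> (e + s k y) = e + s (2 * k) y + s (k^2) (y \<odot> y)"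
proof -
  have "(e + s k y) \<odot> (e + s k y) = e + (s k y + s k y) + s (k^2) (y \<odot> y)"
    using y by (simp add: mul_add mul_scale power2_eq_square add.assoc scale_right_distrib)
  also have "s k y + s k y = s (2 * k) y" by (simp only: mult_2 scale_left_distrib)
  finally show ?thesis .
qed

text \<open>The trace is \<open>P / D\<close>, homogeneous of degree 4 - 3 = 1. That
  \<open>D\<close> is not identically zero on squares is stated separately because the trace will
  also be evaluated at \<open>x \<odot> x\<close>.\<close>

lemma rational_trace:
  obtains D P where "pfun D" "pfun P" "\<exists>x\<in>A. D x \<noteq> 0" "\<exists>x\<in>A. D (x \<odot> x) \<noteq> 0"
    "\<And>c x. x \<in> A \<Longrightarrow> D (s c x) = c^3 * D x" "\<And>c x. x \<in> A \<Longrightarrow> P (s c x) = c^4 * P x"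
    "\<And>x. x \<in> A \<Longrightarrow> D x \<noteq> 0 \<Longrightarrow> indep x \<and> (\<exists>S N. cubic x (P x / D x) S N)"
proof -
  \<comment> \<open>At \<open>x0\<close> the functionals \<open>l2\<close> and \<open>l3\<close>
    read off the coefficients of \<open>x0\<close> and of its square and kill \<open>e\<close>, so
    that \<open>D x0 = 1\<close>; \<open>l1\<close> serves to recover the coefficient of
    \<open>e\<close>.\<close>
  obtain x0 where x0: "x0 \<in> A" "indep x0" using generic_ex[OF generic_indep] by blast
  obtain l1 where l1: "functional l1" "l1 e = 1" using exists_functional[OF x0(2)] by blast
  obtain l2 where l2: "functional l2" "l2 e = 0" "l2 x0 = 1" "l2 (x0 \<odot> x0) = 0"
    using exists_functional[OF x0(2)] by blast
  obtain l3 where l3: "functional l3" "l3 e = 0" "l3 x0 = 0" "l3 (x0 \<odot> x0) = 1"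
    using exists_functional[OF x0(2)] by blast
  note lin = linear_map_onD[OF l1(1)] linear_map_onD[OF l2(1)] linear_map_onD[OF l3(1)]
  \<comment> \<open>Cramer's rule for \<open>x\<^sup>3 = T x\<^sup>2 - S x + N e\<close> modulo \<open>e\<close>: \<open>T = P / D\<close> and \<open>S = - Q / D\<close>\<close>
  define D where "D x = l2 x * l3 (x \<odot> x) - l3 x * l2 (x \<odot> x)" for x
  define P where "P x = l2 x * l3 (x \<odot> (x \<odot> x)) - l3 x * l2 (x \<odot> (x \<odot> x))" for x
  define Q where "Q x = l2 (x \<odot> (x \<odot> x)) * l3 (x \<odot> x) - l3 (x \<odot> (x \<odot> x)) * l2 (x \<odot> x)" for x
  have pm: "pmap (\<lambda>x. x \<odot> x)" "pmap (\<lambda>x. x \<odot> (x \<odot> x))" by (intro pmap_mul pmap_id)+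
  have D: "pfun D" unfolding D_def using pmapD(2)[OF pm(1)] pmapD(2)[OF pmap_id] l2(1) l3(1)
    by (intro pfun_intros)
  have P: "pfun P" unfolding P_def using pmapD(2)[OF pm(2)] pmapD(2)[OF pmap_id] l2(1) l3(1)
    by (intro pfun_intros)
  have Q: "pfun Q" unfolding Q_def using pmapD(2)[OF pm(2)] pmapD(2)[OF pm(1)] l2(1) l3(1)
    by (intro pfun_intros)
  have indep: "indep x" if x: "x \<in> A" "D x \<noteq> 0" for x
    unfolding indep_def
  proof (intro allI impI)
    fix a b c assume z: "comb x a b c = 0"
    have "l2 (comb x a b c) = 0" "l3 (comb x a b c) = 0" "l1 (comb x a b c) = 0"
      unfolding z using functional_0 l1 l2 l3 by auto
    then have *: "b * l2 x + c * l2 (x \<odot> x) = 0" "b * l3 x + c * l3 (x \<odot> x) = 0"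
      "a + b * l1 x + c * l1 (x \<odot> x) = 0"
      using x l1 l2 l3 by (simp_all add: comb_def lin)
    have "c * D x = 0" "b * D x = 0" unfolding D_def using *(1,2) by algebra+
    with x(2) *(3) show "a = 0 \<and> b = 0 \<and> c = 0" by simp
  qed
  \<comment> \<open>The rank hypothesis makes \<open>W x\<close> a multiple of \<open>e\<close>
    generically, hence everywhere, being a polynomial identity. Dividing by \<open>D x\<close> then
    gives a cubic equation at every point with \<open>D x \<noteq> 0\<close>.\<close>
  define W where "W x = s (D x) (x \<odot> (x \<odot> x)) - s (P x) (x \<odot> x) - s (Q x) x" for x
  have W: "pmap W" unfolding W_def by (intro pmap_intros pmap_mul D P Q)
  have W_e: "W x = s (l1 (W x)) e" if x: "x \<in> A" for x
  proof (rule pmap_eq_generic[OF W _ _ x])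
    show "pmap (\<lambda>x. s (l1 (W x)) e)" by (intro pmap_scale pmap_const e_in pmapD(2)[OF W l1(1)])
    show "generic (\<lambda>x. W x = s (l1 (W x)) e)"
    proof (rule generic_mono[OF rank3[unfolded has_rank_3_iff]])
      fix x assume x: "x \<in> A" "indep x \<and> (\<exists>T S N. cubic x T S N)"
      then obtain T S N where cu: "x \<odot> (x \<odot> x) = comb x N (- S) T" unfolding cubic_def by blast
      have l: "l2 (x \<odot> (x \<odot> x)) = - S * l2 x + T * l2 (x \<odot> x)"
        "l3 (x \<odot> (x \<odot> x)) = - S * l3 x + T * l3 (x \<odot> x)"
        unfolding cu using x(1) l2 l3
        by (simp_all add: comb_def lin functional_diff[OF l2(1)] functional_diff[OF l3(1)])
      have PQ: "P x = T * D x" "Q x = - S * D x" unfolding P_def Q_def D_def l by algebra+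
      have "W x = s (D x) (comb x N (- S) T) - s (P x) (comb x 0 0 1) - s (Q x) (comb x 0 1 0)"
        unfolding W_def comb_sq comb_x cu ..
      also have "\<dots> = comb x (D x * N) 0 0"
        unfolding comb_scale comb_diff PQ by (simp add: mult.commute)
      also have "\<dots> = s (D x * N) e" by (simp add: comb_def)
      finally show "W x = s (l1 (W x)) e" using l1 by (simp add: lin)
    qed
  qed
  show ?thesis
  proof (rule that[OF D P])
    show scale: "D (s c x) = c^3 * D x" if "x \<in> A" for c x
      unfolding D_def using that
      by (simp add: mul_scale lin power3_eq_cube algebra_simps)
    show "P (s c x) = c^4 * P x" if "x \<in> A" for c x
      unfolding P_def using that
      by (simp add: mul_scale lin power4_eq_xxxx algebra_simps)
    have "D x0 \<noteq> 0" unfolding D_def using l2 l3 by simp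
    then show "\<exists>x\<in>A. D x \<noteq> 0" using x0 by blast
    \<comment> \<open>The square of \<open>e + s (2 * u) x0\<close> is
      \<open>e + s (4 * u) (x0 + s u (x0 \<odot> x0))\<close>. Since adding \<open>e\<close> to
      \<open>s k y\<close> leaves \<open>D\<close> at \<open>k^3 * D y\<close>, a nonzero
      \<open>u\<close> that is not a root of \<open>p\<close> gives a square with \<open>D\<close>
      nonzero.\<close>
    obtain p where p: "\<forall>u. D (x0 + s u (x0 \<odot> x0)) = poly p u"
      using pfun_line[OF D, of x0 "x0 \<odot> x0"] x0 by blast
    have "p \<noteq> 0" using p[rule_format, of 0] \<open>D x0 \<noteq> 0\<close> by auto
    then obtain u where u: "u \<notin> {0}" "poly p u \<noteq> 0" using poly_nonroot by blast
    have shift: "D (e + s k y) = k^3 * D y" if "y \<in> A" for k y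
    proof -
      note sq = square_shift[OF that, of k]
      have "l2 (e + s k y) = k * l2 y" "l3 (e + s k y) = k * l3 y"
        "l2 ((e + s k y) \<odot> (e + s k y)) = 2 * k * l2 y + k^2 * l2 (y \<odot> y)"
        "l3 ((e + s k y) \<odot> (e + s k y)) = 2 * k * l3 y + k^2 * l3 (y \<odot> y)"
        unfolding sq using that l2 l3 by (simp_all add: lin)
      then show ?thesis unfolding D_def
        by (simp only:) (simp add: algebra_simps power2_eq_square power3_eq_cube)
    qed
    let ?z = "e + s (2 * u) x0"
    have "?z \<odot> ?z = e + s (2 * (2 * u)) x0 + s ((2 * u)^2) (x0 \<odot> x0)"
      by (rule square_shift[OF x0(1)])
    also have "\<dots> = e + s (4 * u) (x0 + s u (x0 \<odot> x0))"
      by (simp add: scale_right_distrib power2_eq_square add.assoc)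
    finally have "D (?z \<odot> ?z) = (4 * u)^3 * poly p u" using shift p x0 by simp
    then show "\<exists>x\<in>A. D (x \<odot> x) \<noteq> 0" using u x0 by (intro bexI[of _ ?z]) auto
    show "indep x \<and> (\<exists>S N. cubic x (P x / D x) S N)" if x: "x \<in> A" "D x \<noteq> 0" for x
    proof (intro conjI exI)
      show "indep x" using indep[OF x] .
      have "s (D x) (x \<odot> (x \<odot> x)) = s (l1 (W x)) e + s (Q x) x + s (P x) (x \<odot> x)"
        unfolding W_e[OF x(1), symmetric] unfolding W_def by simp
      then have "s (1 / D x) (s (D x) (x \<odot> (x \<odot> x))) = s (1 / D x) (comb x (l1 (W x)) (Q x) (P x))"
        by (simp add: comb_def)
      then show "cubic x (P x / D x) (- (Q x / D x)) (l1 (W x) / D x)"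
        unfolding cubic_def comb_scale using x(2) by simp
    qed
  qed
qed

text \<open>On a line \<open>P / D\<close> is a sum of three eigenvalues, hence of at most linear
  growth and affine by \<open>affine_quotient_if_bounded\<close>. Homogeneity of degree one turns
  this into additivity wherever \<open>D\<close> is nonzero, and
  \<open>functional_of_generically_additive\<close> extends the result.\<close>

lemma generic_trace_linear:
  obtains T D where "functional T" "pfun D" "\<exists>x\<in>A. D x \<noteq> 0" "\<exists>x\<in>A. D (x \<odot> x) \<noteq> 0"
    "\<And>x. x \<in> A \<Longrightarrow> D x \<noteq> 0 \<Longrightarrow> indep x \<and> (\<exists>S N. cubic x (T x) S N)"
proof -
  obtain D P where D: "pfun D" and P: "pfun P" and nz: "\<exists>x\<in>A. D x \<noteq> 0" "\<exists>x\<in>A. D (x \<odot> x) \<noteq> 0"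
    and hom: "\<And>c x. x \<in> A \<Longrightarrow> D (s c x) = c^3 * D x" "\<And>c x. x \<in> A \<Longrightarrow> P (s c x) = c^4 * P x"
    and cub: "\<And>x. x \<in> A \<Longrightarrow> D x \<noteq> 0 \<Longrightarrow> indep x \<and> (\<exists>S N. cubic x (P x / D x) S N)"
    by (rule rational_trace) blast
  have "P (x + y) / D (x + y) = P x / D x + P y / D y"
    if x: "x \<in> A" "D x \<noteq> 0" and y: "y \<in> A" "D y \<noteq> 0" and xy: "D (x + y) \<noteq> 0" for x y
  proof -
    obtain f where f: "\<And>t. P (x + s t y) = poly f t" using pfun_line[OF P x(1) y(1)] by blast
    obtain g where g: "\<And>t. D (x + s t y) = poly g t" using pfun_line[OF D x(1) y(1)] by blast
    have "g \<noteq> 0" using g[of 0] x by auto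
    obtain K L where KL: "\<And>t w l. w \<in> A \<Longrightarrow> w \<noteq> 0 \<Longrightarrow> (x + s t y) \<odot> w = s l w \<Longrightarrow> norm l \<le> K + L * norm t"
      by (rule eigenvalue_bound_on_line[OF x(1) y(1)]) blast
    have "norm (poly f t) \<le> (3 * K + 3 * L * norm t) * norm (poly g t)" if t: "poly g t \<noteq> 0" for t
    proof -
      let ?z = "x + s t y"
      have z: "?z \<in> A" "D ?z \<noteq> 0" using x y t g by auto
      obtain S N where c: "indep ?z" "cubic ?z (P ?z / D ?z) S N" using cub[OF z] by blast
      obtain u v w where uvw: "P ?z / D ?z = u + v + w"
        "\<And>r. r \<in> {u, v, w} \<Longrightarrow> r^3 - P ?z / D ?z * r^2 + S * r - N = 0"
        using cubic_root_sum by blast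
      have "norm r \<le> K + L * norm t" if "r \<in> {u, v, w}" for r
        using eigenvalue_of_cubic_root[OF z(1) c(2,1) uvw(2)[OF that]] KL by blast
      then have "norm u \<le> K + L * norm t" "norm v \<le> K + L * norm t" "norm w \<le> K + L * norm t"
        by auto
      then have "norm (u + v + w) \<le> 3 * K + 3 * L * norm t"
        using norm_triangle_ineq[of "u + v" w] norm_triangle_ineq[of u v] by simp
      then have "norm (P ?z / D ?z) * norm (D ?z) \<le> (3 * K + 3 * L * norm t) * norm (D ?z)"
        unfolding uvw(1) by (rule mult_right_mono) simp
      then show ?thesis using z f g by (simp add: norm_divide)
    qed
    then obtain \<alpha> \<beta> where "f = [:\<alpha>, \<beta>:] * g"
      using affine_quotient_if_bounded[of "{t. poly g t = 0}" f "3 * K" "3 * L" g] \<open>g \<noteq> 0\<close>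
      by (auto simp: poly_roots_finite)
    then have line: "P (x + s t y) = (\<alpha> + \<beta> * t) * D (x + s t y)" for t
      unfolding f g by (simp add: algebra_simps)
    obtain f' where f': "\<And>t. P (y + s t x) = poly f' t" using pfun_line[OF P y(1) x(1)] by blast
    obtain g' where g': "\<And>t. D (y + s t x) = poly g' t" using pfun_line[OF D y(1) x(1)] by blast
    \<comment> \<open>homogeneity carries the line from \<open>x\<close> to the line from \<open>y\<close>, whose base point shows \<open>\<beta> = T(y)\<close>\<close>
    have "f' = [:\<beta>, \<alpha>:] * g'"
    proof (rule poly_eq_cofinite[of "{0}"])
      fix t :: complex assume t: "t \<notin> {0}"
      have yx: "y + s t x = s t (x + s (1 / t) y)" using t by (simp add: scale_right_distrib add.commute)
      have "poly f' t = t^4 * ((\<alpha> + \<beta> * (1 / t)) * D (x + s (1 / t) y))"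
        unfolding f'[symmetric] yx line[symmetric] by (rule hom) (use x y in auto)
      also have "\<dots> = (\<alpha> * t + \<beta>) * (t^3 * D (x + s (1 / t) y))"
        using t by (simp add: field_simps power3_eq_cube power4_eq_xxxx)
      also have "t^3 * D (x + s (1 / t) y) = poly g' t"
        unfolding g'[symmetric] yx by (rule hom(1)[symmetric]) (use x y in auto)
      finally show "poly f' t = poly ([:\<beta>, \<alpha>:] * g') t" by (simp add: algebra_simps)
    qed simp
    then have "P y = \<beta> * D y" using f'[of 0] g'[of 0] by simp
    moreover have "P x = \<alpha> * D x" "P (x + y) = (\<alpha> + \<beta>) * D (x + y)"
      using line[of 0] line[of 1] by simp_all
    ultimately show ?thesis using x y xy by simp
  qed
  moreover have "P (s c x) / D (s c x) = c * (P x / D x)" if "x \<in> A" "c \<noteq> 0" for c x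
    using that by (simp add: hom field_simps power3_eq_cube power4_eq_xxxx)
  moreover have "generic (\<lambda>x. D x \<noteq> 0)" using generic_nonzero[OF D] nz(1) by blast
  moreover have "D (s c x) \<noteq> 0" if "x \<in> A" "D x \<noteq> 0" "c \<noteq> 0" for c x using that by (simp add: hom)
  ultimately obtain T where "functional T" "\<forall>x\<in>A. D x \<noteq> 0 \<longrightarrow> T x = P x / D x"
    using functional_of_generically_additive[of "\<lambda>x. D x \<noteq> 0" "\<lambda>x. P x / D x"] by blast
  then show ?thesis using that[of T D] D nz cub by auto
qed

text \<open>Only the trace needs the growth argument. \<open>S\<close> is then forced by the trace
  of the square, and the remaining part \<open>W\<close> of the equation is generically, hence
  always, a multiple of \<open>e\<close>, from which \<open>l\<close> reads off the norm.\<close>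

theorem generic_cubic_equation_exists: "\<exists>T S N. generic_cubic_equation s A mul T S N"
proof -
  obtain T D where T: "functional T" and D: "pfun D"
    and nz: "\<exists>x\<in>A. D x \<noteq> 0" "\<exists>x\<in>A. D (x \<odot> x) \<noteq> 0"
    and cub: "\<And>x. x \<in> A \<Longrightarrow> D x \<noteq> 0 \<Longrightarrow> indep x \<and> (\<exists>S N. cubic x (T x) S N)"
    by (rule generic_trace_linear) blast
  obtain x0 where x0: "x0 \<in> A" "indep x0" using generic_ex[OF generic_indep] by blast
  obtain l where l: "functional l" "l e = 1" using exists_functional[OF x0(2)] by blast
  define S where "S x = ((T x)^2 - T (x \<odot> x)) * (1 / 2)" for x
  define W where "W x = x \<odot> (x \<odot> x) - s (T x) (x \<odot> x) + s (S x) x" for x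
  have sq: "pmap (\<lambda>x. x \<odot> x)" by (intro pmap_mul pmap_id)
  have pT: "pfun T" using T by (rule poly_fun_on.linear)
  have pS: "pfun S" unfolding S_def by (intro pfun_intros pT pmapD(2)[OF sq T])
  have W: "pmap W" unfolding W_def by (intro pmap_intros pmap_mul pT pS)
  have pN: "pfun (\<lambda>x. l (W x))" using pmapD(2)[OF W l(1)] .
  have T_scale: "T (s c x) = c * T x" if "x \<in> A" for c x using linear_map_onD(2)[OF T that] .
  have S_scale: "S (s c x) = c^2 * S x" if "x \<in> A" for c x
    unfolding S_def using that by (simp add: T_scale mul_scale power2_eq_square algebra_simps)
  have W_scale: "W (s c x) = s (c^3) (W x)" if "x \<in> A" for c x
    unfolding W_def using that
    by (simp add: T_scale S_scale mul_scale power2_eq_square power3_eq_cube ac_simps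
        scale_right_distrib scale_right_diff_distrib)
  have "W x = s (l (W x)) e" if "x \<in> A" for x
  proof (rule pmap_eq_generic[OF W _ _ that])
    show "pmap (\<lambda>x. s (l (W x)) e)" by (intro pmap_scale pmap_const e_in pN)
    have "generic (\<lambda>x. D x \<noteq> 0)" "generic (\<lambda>x. D (x \<odot> x) \<noteq> 0)"
      using generic_nonzero[OF D] generic_nonzero[OF pfun_comp[OF D sq]] nz by blast+
    then show "generic (\<lambda>x. W x = s (l (W x)) e)"
    proof (rule generic_mono[OF generic_conj])
      fix x assume x: "x \<in> A" "D x \<noteq> 0 \<and> D (x \<odot> x) \<noteq> 0"
      obtain S' N where c: "cubic x (T x) S' N" using cub x by blast
      obtain S'' N' where c': "indep (x \<odot> x)" "cubic (x \<odot> x) (T (x \<odot> x)) S'' N'"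
        using cub[of "x \<odot> x"] x by blast
      have "T (x \<odot> x) = (T x)^2 - 2 * S'"
        using cubic_unique[OF c' square_generic[OF x(1) c]] by blast
      then have "S x = S'" unfolding S_def by simp
      then have "W x = comb x N (- S x) (T x) - s (T x) (comb x 0 0 1) + s (S x) (comb x 0 1 0)"
        using c unfolding W_def cubic_def comb_sq comb_x by simp
      also have "\<dots> = comb x N 0 0" unfolding comb_scale comb_diff comb_add by simp
      also have "\<dots> = s N e" by (simp add: comb_def)
      finally show "W x = s (l (W x)) e" using l by (simp add: linear_map_onD(2)[OF l(1)])
    qed
  qed
  then have "generic_cubic_equation s A mul T S (\<lambda>x. l (W x))"
    unfolding generic_cubic_equation_def form_on_def e_def[symmetric]
    using pT pS pN T_scale S_scale W_scale pmapD(1)[OF W]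
    by (simp add: linear_map_onD(2)[OF l(1)] W_def[symmetric])
  then show ?thesis by blast
qed

end

section \<open>The twisted double\<close>

lemma finite_dim_basis:
  assumes "vector_space s" "finite_dim s W"
  obtains B where "finite B" "\<not> module.dependent s B" "B \<subseteq> W" "module.span s B = W"
    "card B = vector_space.dim s W"
proof -
  interpret vector_space s by (rule assms(1))
  obtain B0 where B0: "finite B0" "span B0 = W" using assms unfolding finite_dim_def by blast
  obtain B where B: "B \<subseteq> W" "independent B" "W \<subseteq> span B" "card B = dim W"
    using basis_exists by blast
  have "finite B" using independent_span_bound[OF B0(1) B(2)] B(1) B0(2) by simp
  moreover have "span B = W" using B B0 by (metis span_mono span_span subset_antisym)
  ultimately show ?thesis using that B by blast
qed

lemma (in fd_space) finite_dim_subspace: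
  assumes "subspace W" "W \<subseteq> V"
  shows "finite_dim s W"
proof -
  obtain B0 where B0: "finite B0" "span B0 = V" using finite_dim_V unfolding finite_dim_def by blast
  obtain B where B: "B \<subseteq> W" "independent B" "W \<subseteq> span B" by (rule basis_exists[of W]) blast
  have "finite B" using independent_span_bound[OF B0(1) B(2)] B(1) B0(2) assms(2) by simp
  then show ?thesis unfolding finite_dim_def using span_subspace[OF B(1,3) assms(1)] by blast
qed

text \<open>The bases of the factors, each embedded with zero in the other coordinate, together form
  a basis. Their images are disjoint because a basis avoids 0.\<close>

lemma finite_dim_dim_Times:
  fixes s1 :: "complex \<Rightarrow> 'a::ab_group_add \<Rightarrow> 'a" and s2 :: "complex \<Rightarrow> 'b::ab_group_add \<Rightarrow> 'b"
  assumes "vector_space s1" "vector_space s2" and S: "finite_dim s1 S" and T: "finite_dim s2 T"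
  shows "finite_dim (module_prod.scale s1 s2) (S \<times> T)"
    "vector_space.dim (module_prod.scale s1 s2) (S \<times> T) = vector_space.dim s1 S + vector_space.dim s2 T"
proof -
  interpret vs1: vector_space s1 by (rule assms(1))
  interpret vs2: vector_space s2 by (rule assms(2))
  interpret vector_space_prod s1 s2 by unfold_locales
  obtain B where B: "finite B" "vs1.independent B" "B \<subseteq> S" "vs1.span B = S" "card B = vs1.dim S"
    by (rule finite_dim_basis[OF assms(1) S])
  obtain C where C: "finite C" "vs2.independent C" "C \<subseteq> T" "vs2.span C = T" "card C = vs2.dim T"
    by (rule finite_dim_basis[OF assms(2) T])
  let ?i = "\<lambda>b. (b, 0 :: 'b)" and ?j = "\<lambda>c. (0 :: 'a, c)"
  let ?D = "?i ` B \<union> ?j ` C"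
  have "0 \<notin> B" using B(2) vs1.dependent_zero by blast
  then have disj: "?i ` B \<inter> ?j ` C = {}" by auto
  have inj: "inj_on ?i B" "inj_on ?j C" by (auto simp: inj_on_def)
  have ST: "vs1.subspace S" "vs2.subspace T" using B C vs1.subspace_span vs2.subspace_span by blast+
  have card: "card ?D = vs1.dim S + vs2.dim T"
    using card_Un_disjoint[OF _ _ disj] card_image[OF inj(1)] card_image[OF inj(2)] B C by simp
  have fin: "finite ?D" using B C by simp
  have sub: "?D \<subseteq> S \<times> T" using B(3) C(3) vs1.subspace_0[OF ST(1)] vs2.subspace_0[OF ST(2)] by auto
  have ind: "p.independent ?D"
  proof (rule p.independent_if_scalars_zero[OF fin])
    fix f v assume z: "(\<Sum>v\<in>?D. scale (f v) v) = 0" and v: "v \<in> ?D"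
    have "(\<Sum>v\<in>?D. scale (f v) v) =
        (\<Sum>b\<in>B. scale (f (b, 0)) (b, 0)) + (\<Sum>c\<in>C. scale (f (0, c)) (0, c))"
      by (simp add: sum.union_disjoint[OF _ _ disj] sum.reindex[OF inj(1)] sum.reindex[OF inj(2)]
          B(1) C(1) o_def)
    also have "\<dots> = (\<Sum>b\<in>B. s1 (f (b, 0)) b, \<Sum>c\<in>C. s2 (f (0, c)) c)"
      by (simp add: scale_prod prod_eq_iff fst_sum snd_sum)
    finally have "(\<Sum>b\<in>B. s1 (f (b, 0)) b) = 0" "(\<Sum>c\<in>C. s2 (f (0, c)) c) = 0"
      using z by (simp_all add: zero_prod_def)
    then have "\<forall>b\<in>B. f (b, 0) = 0" "\<forall>c\<in>C. f (0, c) = 0"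
      using vs1.independentD[OF B(2,1) subset_refl, of "\<lambda>b. f (b, 0)"]
        vs2.independentD[OF C(2,1) subset_refl, of "\<lambda>c. f (0, c)"] by auto
    then show "f v = 0" using v by auto
  qed
  have "S \<times> T \<subseteq> p.span ?D"
  proof safe
    fix x y assume xy: "x \<in> S" "y \<in> T"
    have "vs1.span B \<subseteq> {x. (x, 0) \<in> p.span ?D}"
    proof (rule vs1.span_minimal)
      show "vs1.subspace {x. (x, 0) \<in> p.span ?D}"
        unfolding vs1.subspace_def
        using p.span_zero p.span_add[of "(_, 0)" ?D "(_, 0)"] p.span_scale[of "(_, 0)" ?D]
        by (auto simp: zero_prod_def scale_prod)
    qed (auto intro: p.span_base)
    moreover have "vs2.span C \<subseteq> {y. (0, y) \<in> p.span ?D}"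
    proof (rule vs2.span_minimal)
      show "vs2.subspace {y. (0, y) \<in> p.span ?D}"
        unfolding vs2.subspace_def
        using p.span_zero p.span_add[of "(0, _)" ?D "(0, _)"] p.span_scale[of "(0, _)" ?D]
        by (auto simp: zero_prod_def scale_prod)
    qed (auto intro: p.span_base)
    ultimately have "(x, 0) + (0, y) \<in> p.span ?D" using xy B C by (intro p.span_add) auto
    then show "(x, y) \<in> p.span ?D" by simp
  qed
  moreover have "p.subspace (S \<times> T)" by (rule subspace_Times[OF ST])
  ultimately have "p.span ?D = S \<times> T" using p.span_subspace[OF sub] by blast
  then show "finite_dim scale (S \<times> T)" unfolding finite_dim_def using fin by blast
  show "p.dim (S \<times> T) = vs1.dim S + vs2.dim T"
    using p.basis_card_eq_dim[OF sub \<open>S \<times> T \<subseteq> p.span ?D\<close> ind] card by simp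
qed

section \<open>The Jordan structure of the twisted double\<close>

locale twisted_double =
  fixes s :: "complex \<Rightarrow> 'a::ab_group_add \<Rightarrow> 'a" and J Jss R :: "'a set"
    and mul :: "'a \<Rightarrow> 'a \<Rightarrow> 'a" (infixl "\<odot>" 70) and \<phi> :: "'a \<Rightarrow> 'a"
  assumes J_jordan: "jordan_algebra s J mul" and J_rank: "has_rank s J mul 3"
    and R_nil: "nil_ideal s J mul R"
    and Jss_sub: "subalgebra s J mul Jss"
    and decomp: "J = {x + m | x m. x \<in> Jss \<and> m \<in> R}" "Jss \<inter> R = {0}"
    and Jss_jordan: "jordan_algebra s Jss mul" and Jss_rank: "has_rank s Jss mul 3"
    and \<phi>_aut: "\<phi> \<in> algebra_automorphisms s Jss mul"

sublocale twisted_double \<subseteq> J: rank3_alg s J mul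
  using J_jordan J_rank by unfold_locales

sublocale twisted_double \<subseteq> K: rank3_alg s Jss mul
  using Jss_jordan Jss_rank by unfold_locales

sublocale twisted_double \<subseteq> p2: vector_space_prod s s
  by unfold_locales

sublocale twisted_double \<subseteq> p3: vector_space_prod s "module_prod.scale s s"
  by unfold_locales

context twisted_double
begin

abbreviation "V \<equiv> Jss \<times> R \<times> R"
abbreviation "t \<equiv> scale3 s"
abbreviation dmul :: "'a \<times> 'a \<times> 'a \<Rightarrow> 'a \<times> 'a \<times> 'a \<Rightarrow> 'a \<times> 'a \<times> 'a" (infixl "\<bullet>\<bullet>" 70)
  where "z \<bullet>\<bullet> w \<equiv> double_mult mul \<phi> z w"

lemma t_Pair: "t c (x, m, n) = (s c x, s c m, s c n)"
  by (simp add: p3.scale_prod p2.scale_prod)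

lemma Jss_in_J [simp, intro]: "x \<in> Jss \<Longrightarrow> x \<in> J"
  using Jss_sub unfolding subalgebra_def by blast

lemma R_subspace: "J.subspace R"
  and R_in_J [simp, intro]: "m \<in> R \<Longrightarrow> m \<in> J"
  and R_ideal [simp, intro]: "a \<in> J \<Longrightarrow> m \<in> R \<Longrightarrow> a \<odot> m \<in> R" "a \<in> J \<Longrightarrow> m \<in> R \<Longrightarrow> m \<odot> a \<in> R"
  using R_nil unfolding nil_ideal_def ideal_of_def by auto

lemma in_R [simp, intro]:
  "0 \<in> R" "m \<in> R \<Longrightarrow> n \<in> R \<Longrightarrow> m + n \<in> R" "m \<in> R \<Longrightarrow> n \<in> R \<Longrightarrow> m - n \<in> R" "m \<in> R \<Longrightarrow> s c m \<in> R"
  using R_subspace by (auto simp: J.subspace_0 J.subspace_add J.subspace_diff J.subspace_scale)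

lemma eq_if_diff_in_R:
  assumes "x \<in> Jss" "y \<in> Jss" "x - y \<in> R"
  shows "x = y"
proof -
  have "x - y \<in> Jss \<inter> R" using assms by (intro IntI K.in_V)
  then show ?thesis unfolding decomp(2) by simp
qed

text \<open>Split the unity of \<open>J\<close> as \<open>x + m\<close>. Multiplying by the unity of
  \<open>Jss\<close> gives \<open>x = K.e\<close> modulo \<open>R\<close>, hence exactly. Then
  \<open>m\<close> is idempotent, and an idempotent in a nil ideal is zero.\<close>

lemma unity_eq: "K.e = J.e"
proof -
  obtain x m where xm: "J.e = x + m" "x \<in> Jss" "m \<in> R" using decomp(1) J.e_in by blast
  have "K.e = K.e \<odot> (x + m)" unfolding xm(1)[symmetric] by simp
  also have "\<dots> = x + K.e \<odot> m" using xm by (simp add: J.mul_add)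
  finally have "K.e - x = K.e \<odot> m" by (simp add: algebra_simps)
  then have x: "K.e = x" using xm by (intro eq_if_diff_in_R) auto
  have "(x + m) \<odot> m = m" "(x + m) \<odot> x = x"
    using J.e_mul(1)[of m] J.e_mul(1)[of x] xm(2,3) unfolding xm(1) by simp_all
  moreover have "x \<odot> x = x" using x xm(2) K.e_mul(1)[of x] by simp
  ultimately have "m \<odot> m = m" using xm by (simp add: J.mul_add J.mul_comm[of m x])
  then have "((\<odot>) m ^^ n) m = m" for n by (induction n) auto
  moreover obtain n where "((\<odot>) m ^^ n) m = 0"
    using R_nil xm(3) unfolding nil_ideal_def by blast
  ultimately show ?thesis using xm x by simp
qed

lemma K_comb: "K.comb = J.comb"
  by (intro ext) (simp add: K.comb_def J.comb_def unity_eq)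

lemma K_cubic: "K.cubic = J.cubic"
  by (intro ext) (simp add: K.cubic_def J.cubic_def K_comb)

lemma \<phi>_in [simp, intro]: "x \<in> Jss \<Longrightarrow> \<phi> x \<in> Jss"
  and \<phi>_add: "x \<in> Jss \<Longrightarrow> y \<in> Jss \<Longrightarrow> \<phi> (x + y) = \<phi> x + \<phi> y"
  and \<phi>_scale: "x \<in> Jss \<Longrightarrow> \<phi> (s c x) = s c (\<phi> x)"
  and \<phi>_mul: "x \<in> Jss \<Longrightarrow> y \<in> Jss \<Longrightarrow> \<phi> (x \<odot> y) = \<phi> x \<odot> \<phi> y"
  and \<phi>_inj: "x \<in> Jss \<Longrightarrow> y \<in> Jss \<Longrightarrow> \<phi> x = \<phi> y \<Longrightarrow> x = y"
  and \<phi>_surj: "x \<in> Jss \<Longrightarrow> \<exists>y\<in>Jss. x = \<phi> y"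
  using \<phi>_aut unfolding algebra_automorphisms_def linear_map_on_def bij_betw_def inj_on_def by auto

lemma \<phi>_e: "\<phi> J.e = J.e"
proof -
  have "is_unity Jss mul (\<phi> K.e)"
    unfolding is_unity_def using \<phi>_surj \<phi>_mul[of K.e] \<phi>_mul[of _ K.e] by fastforce
  from K.unity_eqI[OF this] have "\<phi> K.e = K.e" by (simp only: K.e_def)
  then show ?thesis unfolding unity_eq .
qed

lemma e_in_Jss [simp, intro]: "J.e \<in> Jss"
  using K.e_in unity_eq by simp

text \<open>The maps \<open>\<pi>\<^sub>1\<close> and \<open>\<pi>\<^sub>2\<close> embed the twisted double as a subalgebra of \<open>J \<times> J\<close>.\<close>

definition \<pi>\<^sub>1 :: "'a \<times> 'a \<times> 'a \<Rightarrow> 'a" where "\<pi>\<^sub>1 z = fst z + fst (snd z)"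
definition \<pi>\<^sub>2 :: "'a \<times> 'a \<times> 'a \<Rightarrow> 'a" where "\<pi>\<^sub>2 z = \<phi> (fst z) + snd (snd z)"

text \<open>Including \<open>fst\<close> makes joint injectivity immediate: once the first
  components agree, \<open>\<pi>\<^sub>1\<close> and \<open>\<pi>\<^sub>2\<close> determine the
  others.\<close>

definition emb :: "('a \<times> 'a \<times> 'a \<Rightarrow> 'a) \<Rightarrow> bool" where "emb f \<longleftrightarrow> f \<in> {fst, \<pi>\<^sub>1, \<pi>\<^sub>2}"

lemma emb_in: "emb f \<Longrightarrow> z \<in> V \<Longrightarrow> f z \<in> J"
  unfolding emb_def by (auto simp: \<pi>\<^sub>1_def \<pi>\<^sub>2_def)

lemma emb_add: "emb f \<Longrightarrow> z \<in> V \<Longrightarrow> w \<in> V \<Longrightarrow> f (z + w) = f z + f w"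
  unfolding emb_def by (auto simp: \<pi>\<^sub>1_def \<pi>\<^sub>2_def \<phi>_add algebra_simps)

lemma emb_scale: "emb f \<Longrightarrow> z \<in> V \<Longrightarrow> f (t c z) = s c (f z)"
  unfolding emb_def by (auto simp: \<pi>\<^sub>1_def \<pi>\<^sub>2_def \<phi>_scale t_Pair J.scale_right_distrib)

lemma mul_decomp:
  assumes "x \<in> Jss" "x' \<in> Jss" "m \<in> R" "m' \<in> R"
  shows "(x + m) \<odot> (x' + m') = x \<odot> x' + (x \<odot> m' + x' \<odot> m + m \<odot> m')"
proof -
  have "(x + m) \<odot> (x' + m') = (x \<odot> x' + x \<odot> m') + (m \<odot> x' + m \<odot> m')"
    using assms by (simp add: J.mul_add add_ac)
  also have "m \<odot> x' = x' \<odot> m" using assms by (intro J.mul_comm) auto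
  finally show ?thesis by (simp add: add_ac)
qed

text \<open>The second and third components of the product are the \<open>R\<close> parts of
  products in \<open>J\<close>; for \<open>\<pi>\<^sub>2\<close> the \<open>Jss\<close> part matches
  because \<phi> is multiplicative.\<close>

lemma emb_mul:
  assumes "emb f" "z \<in> V" "w \<in> V"
  shows "f (z \<bullet>\<bullet> w) = f z \<odot> f w"
proof -
  obtain x m n x' m' n' where zw: "z = (x, m, n)" "w = (x', m', n')"
    and in': "x \<in> Jss" "x' \<in> Jss" "m \<in> R" "m' \<in> R" "n \<in> R" "n' \<in> R"
    using assms(2,3) by auto
  have "\<pi>\<^sub>1 (z \<bullet>\<bullet> w) = \<pi>\<^sub>1 z \<odot> \<pi>\<^sub>1 w"
    unfolding zw \<pi>\<^sub>1_def using mul_decomp[OF in'(1-4)] by simp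
  moreover have "\<pi>\<^sub>2 (z \<bullet>\<bullet> w) = \<pi>\<^sub>2 z \<odot> \<pi>\<^sub>2 w"
    unfolding zw \<pi>\<^sub>2_def using mul_decomp[OF \<phi>_in[OF in'(1)] \<phi>_in[OF in'(2)] in'(5,6)] in' \<phi>_mul
    by simp
  ultimately show ?thesis using assms(1) unfolding emb_def by (auto simp: zw)
qed

lemma emb_inj:
  assumes "\<And>f. emb f \<Longrightarrow> f z = f w"
  shows "z = w"
  using assms[of fst] assms[of \<pi>\<^sub>1] assms[of \<pi>\<^sub>2]
  by (auto simp: emb_def \<pi>\<^sub>1_def \<pi>\<^sub>2_def prod_eq_iff)

lemma dmul_in [simp, intro]: "z \<in> V \<Longrightarrow> w \<in> V \<Longrightarrow> z \<bullet>\<bullet> w \<in> V"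
  by (cases z; cases w) auto

lemma V_subspace: "p3.p.subspace V"
  by (intro p3.subspace_Times p2.subspace_Times R_subspace K.subspace_V)

lemma in_V [simp, intro]: "z \<in> V \<Longrightarrow> w \<in> V \<Longrightarrow> z + w \<in> V" "z \<in> V \<Longrightarrow> t c z \<in> V"
  using V_subspace by (auto simp only: p3.p.subspace_add p3.p.subspace_scale)

lemma finite_dim_R: "finite_dim s R"
  by (rule J.finite_dim_subspace[OF R_subspace]) auto

lemma finite_dim_V: "finite_dim t V" and dim_V: "p3.p.dim V = J.dim Jss + 2 * J.dim R"
proof -
  note RR = finite_dim_dim_Times[OF J.vector_space_axioms J.vector_space_axioms finite_dim_R finite_dim_R]
  show "finite_dim t V" by (rule finite_dim_dim_Times(1)[OF J.vector_space_axioms p2.p.vector_space_axioms K.finite_dim_V RR(1)])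
  show "p3.p.dim V = J.dim Jss + 2 * J.dim R"
    using finite_dim_dim_Times(2)[OF J.vector_space_axioms p2.p.vector_space_axioms K.finite_dim_V RR(1)] RR(2) by simp
qed

lemma is_unity_dmul: "is_unity V (double_mult mul \<phi>) (J.e, 0, 0)"
proof -
  have 0: "x \<odot> 0 = 0" if "x \<in> J" for x using J.mul_scale(1)[of x x 0] that by simp
  show ?thesis unfolding is_unity_def by (auto simp: \<phi>_e 0 J.mul_comm[of 0])
qed

text \<open>Each algebraic identity is checked after applying the maps of \<open>emb\<close>, where
  it becomes an identity of \<open>J\<close>.\<close>

lemma jordan_dmul: "jordan_algebra t V (double_mult mul \<phi>)"
  unfolding jordan_algebra_def
proof (intro conjI ballI)
  show "vector_space t" by (rule p3.p.vector_space_axioms)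
  show "p3.p.subspace V" by (rule V_subspace)
  show "finite_dim t V" by (rule finite_dim_V)
  show "\<exists>u. is_unity V (double_mult mul \<phi>) u" using is_unity_dmul by blast
  fix z assume z: "z \<in> V"
  show "linear_map_on t V t (double_mult mul \<phi> z)"
  proof (rule linear_map_onI; rule emb_inj)
    fix f x y assume "emb f" "x \<in> V" "y \<in> V"
    then show "f (z \<bullet>\<bullet> (x + y)) = f (z \<bullet>\<bullet> x + z \<bullet>\<bullet> y)"
      using z by (simp only: emb_mul emb_add emb_in dmul_in in_V J.mul_add)
  next
    fix f c x assume "emb f" "x \<in> V"
    then show "f (z \<bullet>\<bullet> t c x) = f (t c (z \<bullet>\<bullet> x))"
      using z by (simp only: emb_mul emb_scale emb_in dmul_in in_V J.mul_scale)
  qed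
  fix w assume w: "w \<in> V"
  show "z \<bullet>\<bullet> w \<in> V" using z w by (rule dmul_in)
  show "z \<bullet>\<bullet> w = w \<bullet>\<bullet> z"
    by (rule emb_inj) (use z w in \<open>simp only: emb_mul emb_in J.mul_comm\<close>)
  show "z \<bullet>\<bullet> z \<bullet>\<bullet> (z \<bullet>\<bullet> w) = z \<bullet>\<bullet> (z \<bullet>\<bullet> z \<bullet>\<bullet> w)"
    by (rule emb_inj) (use z w in \<open>simp only: emb_mul emb_in dmul_in J.jordan_identity\<close>)
qed

end

section \<open>The rank of the twisted double\<close>

sublocale twisted_double \<subseteq> W: jordan_alg "scale3 s" "Jss \<times> R \<times> R" "double_mult mul \<phi>"
  by unfold_locales (rule jordan_dmul)

context twisted_double
begin

lemma W_e: "W.e = (J.e, 0, 0)"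
  using W.unity_eqI[OF is_unity_dmul] unfolding W.e_def .

lemma emb_e: "emb f \<Longrightarrow> f W.e = J.e"
  unfolding emb_def W_e by (auto simp: \<pi>\<^sub>1_def \<pi>\<^sub>2_def \<phi>_e)

lemma emb_comb: "emb f \<Longrightarrow> z \<in> V \<Longrightarrow> f (W.comb z a b c) = J.comb (f z) a b c"
  unfolding W.comb_def J.comb_def
  by (simp only: emb_add emb_scale emb_mul emb_e in_V dmul_in W.e_in)

text \<open>Powers of \<open>x + m\<close> and of \<open>x\<close> agree modulo the ideal
  \<open>R\<close>, so the equation descends to \<open>x\<close> up to an element of
  \<open>R\<close>. Both sides lie in \<open>Jss\<close>, which meets \<open>R\<close> in
  zero.\<close>

lemma cubic_mod_R:
  assumes x: "x \<in> Jss" and m: "m \<in> R" and c: "J.cubic (x + m) T S N"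
  shows "J.cubic x T S N"
proof -
  define y where "y = x + m"
  have y: "y \<in> J" "y - x \<in> R" using x m by (auto simp: y_def)
  have congr: "u \<odot> v - u' \<odot> v' \<in> R"
    if "u \<in> J" "v \<in> J" "u' \<in> J" "v' \<in> J" "u - u' \<in> R" "v - v' \<in> R" for u v u' v'
  proof -
    have "u \<odot> v = u' \<odot> v + (u - u') \<odot> v" "u' \<odot> v = u' \<odot> v' + u' \<odot> (v - v')"
      using J.mul_add(2)[of v u' "u - u'"] J.mul_add(1)[of u' v' "v - v'"] that by auto
    then have "u \<odot> v - u' \<odot> v' = (u - u') \<odot> v + u' \<odot> (v - v')" by simp
    then show ?thesis using that by auto
  qed
  have 2: "y \<odot> y - x \<odot> x \<in> R" using y x by (intro congr) auto
  have 3: "y \<odot> (y \<odot> y) - x \<odot> (x \<odot> x) \<in> R" using y x 2 by (intro congr) auto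
  have "J.comb y N (- S) T - J.comb x N (- S) T = s (- S) (y - x) + s T (y \<odot> y - x \<odot> x)"
    unfolding J.comb_def by (simp add: J.scale_right_diff_distrib)
  also have "\<dots> \<in> R" by (rule in_R(2)[OF in_R(4)[OF y(2)] in_R(4)[OF 2]])
  finally have "(y \<odot> (y \<odot> y) - x \<odot> (x \<odot> x)) - (J.comb y N (- S) T - J.comb x N (- S) T) \<in> R"
    by (rule in_R(3)[OF 3])
  then have "J.comb x N (- S) T - x \<odot> (x \<odot> x) \<in> R"
    using c unfolding J.cubic_def y_def[symmetric] by simp
  then have "J.comb x N (- S) T = x \<odot> (x \<odot> x)"
    using K.comb_in[OF x] K.mul_in[OF x K.mul_in[OF x x]] unfolding K_comb
    by (intro eq_if_diff_in_R)
  then show ?thesis unfolding J.cubic_def by (rule sym)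
qed

text \<open>The equation of \<open>\<phi> x\<close> is the image under \<phi> of the same equation
  for \<open>x\<close>, and \<phi> is injective.\<close>

lemma cubic_\<phi>:
  assumes x: "x \<in> Jss" and c: "J.cubic (\<phi> x) T S N"
  shows "J.cubic x T S N"
proof -
  have "\<phi> (J.comb x N (- S) T) = J.comb (\<phi> x) N (- S) T"
    unfolding J.comb_def using x by (simp add: \<phi>_add \<phi>_scale \<phi>_mul \<phi>_e del: J.scale_minus_left)
  also have "\<dots> = \<phi> (x \<odot> (x \<odot> x))" using c x unfolding J.cubic_def by (simp add: \<phi>_mul)
  finally have "J.comb x N (- S) T = x \<odot> (x \<odot> x)"
    by (rule \<phi>_inj[OF K.comb_in[OF x, unfolded K_comb] K.mul_in[OF x K.mul_in[OF x x]]])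
  then show ?thesis unfolding J.cubic_def by (rule sym)
qed

text \<open>Both given equations descend to the component in \<open>Jss\<close>, whose independence
  forces equal coefficients. All maps of \<open>emb\<close> then send \<open>z\<close> to solutions
  of one cubic, and joint injectivity lifts it to \<open>z\<close>.\<close>

lemma cubic_dmul:
  assumes z: "z \<in> V" and ind: "K.indep (fst z)"
    and c: "J.cubic (\<pi>\<^sub>1 z) T S N" "J.cubic (\<pi>\<^sub>2 z) T' S' N'"
  shows "W.indep z \<and> W.cubic z T S N"
proof
  have emb: "emb fst" "emb \<pi>\<^sub>1" "emb \<pi>\<^sub>2" by (auto simp: emb_def)
  show "W.indep z" unfolding W.indep_def
  proof (intro allI impI)
    fix a b c assume "W.comb z a b c = 0"
    then have "K.comb (fst z) a b c = 0"
      using emb_comb[OF emb(1) z, of a b c] unfolding K_comb by (simp add: zero_prod_def)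
    then show "a = 0 \<and> b = 0 \<and> c = 0" by (rule K.indepD[OF ind])
  qed
  have x: "fst z \<in> Jss" and m: "fst (snd z) \<in> R" "snd (snd z) \<in> R" using z by auto
  have 1: "J.cubic (fst z) T S N" using cubic_mod_R[OF x m(1)] c(1) by (simp add: \<pi>\<^sub>1_def)
  have 2: "J.cubic (fst z) T' S' N'"
    using cubic_\<phi>[OF x cubic_mod_R[OF \<phi>_in[OF x] m(2)]] c(2) by (simp add: \<pi>\<^sub>2_def)
  have "T = T'" "S = S'" "N = N'" using K.cubic_unique[OF ind] 1 2 unfolding K_cubic by blast+
  then have "J.cubic (f z) T S N" if "emb f" for f using that 1 c unfolding emb_def by auto
  then show "W.cubic z T S N"
    unfolding W.cubic_def J.cubic_def
    by (intro emb_inj) (simp only: emb_comb emb_mul z dmul_in)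
qed

text \<open>The maps \<open>fst\<close>, \<open>\<pi>\<^sub>1\<close> and
  \<open>\<pi>\<^sub>2\<close> are surjective onto \<open>Jss\<close>, \<open>J\<close> and
  \<open>J\<close>, so the conditions required by \<open>cubic_dmul\<close> pull back to generic
  conditions and hold together.\<close>

lemma rank3_dmul: "has_rank t V (double_mult mul \<phi>) 3"
proof -
  have lin: "linear_map_on t V s f" if "emb f" for f
    by (rule linear_map_onI) (simp_all only: emb_add[OF that] emb_scale[OF that])
  have "fst ` V = Jss" by force
  moreover have "\<pi>\<^sub>1 ` V = J"
  proof
    show "J \<subseteq> \<pi>\<^sub>1 ` V"
      unfolding decomp(1) by (auto intro!: image_eqI[of _ _ "(_, _, 0)"] simp: \<pi>\<^sub>1_def)
  qed (use emb_in in \<open>auto simp: emb_def\<close>)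
  moreover have "\<pi>\<^sub>2 ` V = J"
  proof
    show "J \<subseteq> \<pi>\<^sub>2 ` V"
    proof
      fix y assume "y \<in> J"
      then obtain x m where "y = x + m" "x \<in> Jss" "m \<in> R" using decomp(1) by blast
      moreover then obtain x' where "x' \<in> Jss" "x = \<phi> x'" using \<phi>_surj by blast
      ultimately show "y \<in> \<pi>\<^sub>2 ` V" by (intro image_eqI[of _ _ "(x', 0, m)"]) (auto simp: \<pi>\<^sub>2_def)
    qed
  qed (use emb_in in \<open>auto simp: emb_def\<close>)
  ultimately have "generically t V (\<lambda>z. K.indep (fst z))"
    "generically t V (\<lambda>z. J.indep (\<pi>\<^sub>1 z) \<and> (\<exists>T S N. J.cubic (\<pi>\<^sub>1 z) T S N))"
    "generically t V (\<lambda>z. J.indep (\<pi>\<^sub>2 z) \<and> (\<exists>T S N. J.cubic (\<pi>\<^sub>2 z) T S N))"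
    using generically_comp_linear[OF K.generic_indep lin]
      generically_comp_linear[OF J_rank[unfolded J.has_rank_3_iff] lin]
    unfolding emb_def by auto
  then have "generically t V (\<lambda>z. K.indep (fst z) \<and>
      (J.indep (\<pi>\<^sub>1 z) \<and> (\<exists>T S N. J.cubic (\<pi>\<^sub>1 z) T S N)) \<and>
      (J.indep (\<pi>\<^sub>2 z) \<and> (\<exists>T S N. J.cubic (\<pi>\<^sub>2 z) T S N)))"
    by (intro W.generic_conj[OF _ W.generic_conj])
  then show ?thesis unfolding W.has_rank_3_iff
  proof (rule W.generic_mono, elim conjE exE)
    fix z T S N T' S' N'
    assume "z \<in> V" "K.indep (fst z)" "J.cubic (\<pi>\<^sub>1 z) T S N" "J.cubic (\<pi>\<^sub>2 z) T' S' N'"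
    then have "W.indep z \<and> W.cubic z T S N" by (rule cubic_dmul)
    then show "W.indep z \<and> (\<exists>T S N. W.cubic z T S N)" by blast
  qed
qed

end

theorem mainTheorem9:
  fixes s :: "complex \<Rightarrow> 'a::ab_group_add \<Rightarrow> 'a"
    and J Jss R :: "'a set"
    and mul :: "'a \<Rightarrow> 'a \<Rightarrow> 'a"
    and r :: nat
  assumes J: "jordan_algebra s J mul" "has_rank s J mul 3"
    and R: "is_radical s J mul R" "r = vector_space.dim s R" "r > 0"
    and Jss_sub: "subalgebra s J mul Jss"
    and decomp: "J = {x + m | x m. x \<in> Jss \<and> m \<in> R}" "Jss \<inter> R = {0}"
    and Jss: "jordan_algebra s Jss mul" "simple_algebra s Jss mul" "has_rank s Jss mul 3"
  shows "\<forall>\<phi> \<in> algebra_automorphisms s Jss mul.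
    (let V = Jss \<times> R \<times> R; t = scale3 s; mul' = double_mult mul \<phi>;
         n = vector_space.dim s Jss + 2 * r
     in jordan_algebra t V mul' \<and> has_rank t V mul' 3 \<and> vector_space.dim t V = n \<and>
        (\<exists>T S N. generic_cubic_equation t V mul' T S N) \<and>
        (\<forall>T S N. generic_cubic_equation t V mul' T S N \<longrightarrow>
           quadro_quadric_cremona t V (n - 1) (jordan_adjoint t V mul' T S)))"
proof
  fix \<phi> assume \<phi>: "\<phi> \<in> algebra_automorphisms s Jss mul"
  have "nil_ideal s J mul R" using R(1) unfolding is_radical_def by blast
  then interpret twisted_double s J Jss R mul \<phi>
    by (intro twisted_double.intro J Jss Jss_sub decomp \<phi>)
  interpret D: rank3_alg "scale3 s" "Jss \<times> R \<times> R" "double_mult mul \<phi>"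
    by (intro rank3_alg.intro jordan_alg.intro rank3_alg_axioms.intro jordan_dmul rank3_dmul)
  have dim: "vector_space.dim t V = vector_space.dim s Jss + 2 * r" using dim_V R(2) by simp
  \<comment> \<open>Since \<open>r > 0\<close>, the truncated subtraction is the true one, and
    \<open>n - 1\<close> is the dimension of the projective space of lines in
    \<open>V\<close>.\<close>
  then have "vector_space.dim t V = (vector_space.dim s Jss + 2 * r - 1) + 1" using R(3) by simp
  then show "let V = Jss \<times> R \<times> R; t = scale3 s; mul' = double_mult mul \<phi>;
         n = vector_space.dim s Jss + 2 * r
     in jordan_algebra t V mul' \<and> has_rank t V mul' 3 \<and> vector_space.dim t V = n \<and>
        (\<exists>T S N. generic_cubic_equation t V mul' T S N) \<and>
        (\<forall>T S N. generic_cubic_equation t V mul' T S N \<longrightarrow>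
           quadro_quadric_cremona t V (n - 1) (jordan_adjoint t V mul' T S))"
    unfolding Let_def
    using jordan_dmul rank3_dmul dim D.generic_cubic_equation_exists D.quadro_quadric_adjoint
    by blast
qed

end
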